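(* Let $X,Y$ be Banach spaces, $D\subset X$ a nonempty open convex set, and $F:D\to Y$ an analytic operator. Let $x_0\in D$ be such that $F'(x_0)$ is nonsingular, let $$\gamma:=\sup_{k>1}\left\|\frac{F'(x_0)^{-1}F^{(k)}(x_0)}{k!}\right\|^{\frac1{k-1}},$$ and assume $\gamma>0$ and $B(x_0,1/\gamma)\subset D$. Let $\beta>0$ satisfy $\|F'(x_0)^{-1}F(x_0)\|\le\beta$. If $\alpha:=\beta\gamma<3-2\sqrt2$, then, with $$t^*=\frac{1+\alpha-\sqrt{(1+\alpha)^2-8\alpha}}{4\gamma},\qquad t^{**}=\frac{1+\alpha+\sqrt{(1+\alpha)^2-8\alpha}}{4\gamma},$$ the sequence $\{x_k\}$ generated by Halley's method $$x_{k+1}=x_k-[I-L_F(x_k)]^{-1}F'(x_k)^{-1}F(x_k),\quad k=0,1,2,\ldots,$$ with starting point $x_0$ is well defined, is contained in $B(x_0,t^* )$, and converges to a point $x^*\in\overline{B(x_0,t^* )}$ which is a solution of $F(x)=0$. The limit $x^*$ is the unique zero of $F$ in $B(x_0,t^{**})$. Moreover, with $\{t_k\}$ the Halley sequence for $f$ started at $t_0=0$ (defined in the context), for all $k=0,1,\ldots$, $$\|x^*-x_{k+1}\|\le(t^*-t_{k+1})\left(\frac{\|x^*-x_k\|}{t^*-t_k}\right)^3$$ and $$\|x^*-x_{k+1}\|\le\frac{8\gamma^2}{3[2(1-\gamma t^* )^2-1]^2}\,\|x^*-x_k\|^3.$$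
   Context: $B(x,r)$ is the open ball with center $x$ and radius $r$, and $\overline{B(x,r)}$ its closure. $I$ is the identity operator. $L_F(x)=\frac12F'(x)^{-1}F''(x)F'(x)^{-1}F(x)$, i.e. the bounded linear operator $v\mapsto\frac12F'(x)^{-1}F''(x)\big(F'(x)^{-1}F(x),v\big)$ on $X$. The function $f$ is $f(t)=\beta-t+\frac{\gamma t^2}{1-\gamma t}$ for $0\le t<1/\gamma$. Halley sequence for $f$: $t_0=0$, $t_{k+1}=t_k-\frac{1}{1-L_f(t_k)}\cdot\frac{f(t_k)}{f'(t_k)}$, where $L_f(t)=\frac{f(t)f''(t)}{2f'(t)^2}$. *)

theory Defs
  imports "HOL-Analysis.Analysis"
begin

text \<open>
  A \<open>k\<close>-linear map from \<open>X\<close> to \<open>Y\<close> is represented by a function on lists of vectors; only its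
  values on lists of length \<open>k\<close> are meaningful.
\<close>

definition bounded_multilinear ::
    "nat \<Rightarrow> ('a::real_normed_vector list \<Rightarrow> 'b::real_normed_vector) \<Rightarrow> bool" where
  "bounded_multilinear k T \<longleftrightarrow>
     (\<forall>vs i. length vs = k \<longrightarrow> i < k \<longrightarrow> linear (\<lambda>v. T (vs[i := v]))) \<and>
     (\<exists>C. \<forall>vs. length vs = k \<longrightarrow> norm (T vs) \<le> C * (\<Prod>v\<leftarrow>vs. norm v))"

definition multilinear_norm ::
    "nat \<Rightarrow> ('a::real_normed_vector list \<Rightarrow> 'b::real_normed_vector) \<Rightarrow> real" where
  "multilinear_norm k T =
     (SUP vs \<in> {vs. length vs = k \<and> (\<forall>v \<in> set vs. norm v \<le> 1)}. norm (T vs))"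

text \<open>
  Frechet differentiability at \<open>x\<close> of a map \<open>G\<close> whose values are \<open>k\<close>-linear maps: the derivative is
  identified with the bounded \<open>(k+1)\<close>-linear map \<open>T\<close> taking the increment as first argument.
  Bounding the remainder by \<open>e * norm h * (\<Prod>v\<leftarrow>vs. norm v)\<close> for all \<open>vs\<close> says that its
  operator norm is at most \<open>e * norm h\<close>.
\<close>

definition has_multilinear_derivative ::
    "nat \<Rightarrow> ('a::real_normed_vector \<Rightarrow> 'a list \<Rightarrow> 'b::real_normed_vector) \<Rightarrow>
     ('a list \<Rightarrow> 'b) \<Rightarrow> 'a \<Rightarrow> bool" where
  "has_multilinear_derivative k G T x \<longleftrightarrow>
     bounded_multilinear (Suc k) T \<and>
     (\<forall>e>0. \<forall>\<^sub>F h in nhds 0. \<forall>vs. length vs = k \<longrightarrow>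
        norm (G (x + h) vs - G x vs - T (h # vs)) \<le> e * norm h * (\<Prod>v\<leftarrow>vs. norm v))"

primrec nth_frechet_derivative ::
    "('a::real_normed_vector \<Rightarrow> 'b::real_normed_vector) \<Rightarrow> nat \<Rightarrow> 'a \<Rightarrow> 'a list \<Rightarrow> 'b" where
  "nth_frechet_derivative F 0 = (\<lambda>x vs. F x)"
| "nth_frechet_derivative F (Suc k) =
     (\<lambda>x. SOME T. has_multilinear_derivative k (nth_frechet_derivative F k) T x)"

text \<open>
  Analytic operators between real normed spaces: all Frechet derivatives exist, and near every
  point the operator is the sum of its Taylor series.  Complex Banach spaces are covered by
  regarding them as real ones.
\<close>

definition analytic_operator_on ::
    "('a::real_normed_vector \<Rightarrow> 'b::real_normed_vector) \<Rightarrow> 'a set \<Rightarrow> bool" where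
  "analytic_operator_on F D \<longleftrightarrow>
     (\<forall>x\<in>D. \<forall>k. \<exists>T. has_multilinear_derivative k (nth_frechet_derivative F k) T x) \<and>
     (\<forall>x\<in>D. \<exists>r>0. \<forall>h. norm h < r \<longrightarrow>
        (\<lambda>k. nth_frechet_derivative F k x (replicate k h) /\<^sub>R fact k) sums F (x + h))"

definition nonsingular :: "('a::real_normed_vector \<Rightarrow> 'b::real_normed_vector) \<Rightarrow> bool" where
  "nonsingular A \<longleftrightarrow> bounded_linear A \<and> bij A \<and> bounded_linear (inv A)"

text \<open>
  \<open>smale_gamma\<close> is extended-real valued, so that an unbounded family has supremum \<open>\<infinity>\<close>.
\<close>

definition smale_gamma ::
    "('a::real_normed_vector \<Rightarrow> 'b::real_normed_vector) \<Rightarrow> 'a \<Rightarrow> ereal" where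
  "smale_gamma F x =
     (SUP k \<in> {k::nat. k > 1}. ereal (root (k - 1)
        (multilinear_norm k
          (\<lambda>vs. inv (frechet_derivative F (at x)) (nth_frechet_derivative F k x vs) /\<^sub>R fact k))))"

definition halley_L ::
    "('a::real_normed_vector \<Rightarrow> 'b::real_normed_vector) \<Rightarrow> 'a \<Rightarrow> 'a \<Rightarrow> 'a" where
  "halley_L F x v =
     (let F'inv = inv (frechet_derivative F (at x))
      in (1/2) *\<^sub>R F'inv (nth_frechet_derivative F 2 x [F'inv (F x), v]))"

primrec halley_seq ::
    "('a::real_normed_vector \<Rightarrow> 'b::real_normed_vector) \<Rightarrow> 'a \<Rightarrow> nat \<Rightarrow> 'a" where
  "halley_seq F x0 0 = x0"
| "halley_seq F x0 (Suc k) =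
     (let x = halley_seq F x0 k
      in x - inv (\<lambda>v. v - halley_L F x v) (inv (frechet_derivative F (at x)) (F x)))"

definition halley_seq_well_defined ::
    "('a::real_normed_vector \<Rightarrow> 'b::real_normed_vector) \<Rightarrow> 'a set \<Rightarrow> 'a \<Rightarrow> bool" where
  "halley_seq_well_defined F D x0 \<longleftrightarrow>
     (\<forall>k. let x = halley_seq F x0 k
          in x \<in> D \<and> nonsingular (frechet_derivative F (at x)) \<and>
             nonsingular (\<lambda>v. v - halley_L F x v))"

definition majorant :: "real \<Rightarrow> real \<Rightarrow> real \<Rightarrow> real" where
  "majorant \<beta> \<gamma> t = \<beta> - t + \<gamma> * t\<^sup>2 / (1 - \<gamma> * t)"

definition scalar_halley_L :: "(real \<Rightarrow> real) \<Rightarrow> real \<Rightarrow> real" where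
  "scalar_halley_L f t = f t * deriv (deriv f) t / (2 * (deriv f t)\<^sup>2)"

primrec scalar_halley_seq :: "(real \<Rightarrow> real) \<Rightarrow> real \<Rightarrow> nat \<Rightarrow> real" where
  "scalar_halley_seq f t0 0 = t0"
| "scalar_halley_seq f t0 (Suc k) =
     (let t = scalar_halley_seq f t0 k
      in t - 1 / (1 - scalar_halley_L f t) * (f t / deriv f t))"

text \<open>
  The derivatives of orders 1 and 2 agree with the library's Frechet derivative (for order 2, taken
  in the space of bounded linear functions).
\<close>

lemma has_multilinear_derivative_unique:
  fixes G :: "'a::real_normed_vector \<Rightarrow> 'a list \<Rightarrow> 'b::real_normed_vector"
  assumes S: "has_multilinear_derivative k G S x" and T: "has_multilinear_derivative k G T x"
    and vs: "length vs = k"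
  shows "S (u # vs) = T (u # vs)"
proof -
  have *: "((\<lambda>y. G y vs) has_derivative (\<lambda>h. A (h # vs))) (at x)"
    if A: "has_multilinear_derivative k G A x" for A
    unfolding has_derivative_at_alt
  proof (intro conjI allI impI)
    from A have ml: "bounded_multilinear (Suc k) A"
      by (simp add: has_multilinear_derivative_def)
    then obtain C where C: "\<And>ws. length ws = Suc k \<Longrightarrow> norm (A ws) \<le> C * (\<Prod>v\<leftarrow>ws. norm v)"
      unfolding bounded_multilinear_def by blast
    have "linear (\<lambda>v. A ((0 # vs)[0 := v]))"
      using ml vs unfolding bounded_multilinear_def by (metis length_Cons zero_less_Suc)
    then have lin: "linear (\<lambda>v. A (v # vs))"
      by simp
    have "norm (A (v # vs)) \<le> norm v * (C * (\<Prod>v\<leftarrow>vs. norm v))" for v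
      using C[of "v # vs"] vs by (simp add: algebra_simps)
    with lin show "bounded_linear (\<lambda>h. A (h # vs))"
      by (auto intro!: bounded_linear.intro bounded_linear_axioms.intro)
  next
    fix e :: real assume "e > 0"
    define P where "P = (\<Prod>v\<leftarrow>vs. norm v)"
    have P: "P \<ge> 0"
      unfolding P_def by (induction vs) auto
    define e' where "e' = e / (P + 1)"
    have e': "e' > 0" "e' * P \<le> e"
      using \<open>e > 0\<close> P by (auto simp: e'_def field_simps)
    from A e'(1) have "\<forall>\<^sub>F h in nhds 0. \<forall>vs. length vs = k \<longrightarrow>
        norm (G (x + h) vs - G x vs - A (h # vs)) \<le> e' * norm h * (\<Prod>v\<leftarrow>vs. norm v)"
      unfolding has_multilinear_derivative_def by blast
    then have "\<forall>\<^sub>F h in nhds 0. norm (G (x + h) vs - G x vs - A (h # vs)) \<le> e' * norm h * P"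
      unfolding P_def by (rule eventually_mono) (use vs in blast)
    then obtain d where d: "d > 0" and
      bd: "\<And>h. norm h < d \<Longrightarrow> norm (G (x + h) vs - G x vs - A (h # vs)) \<le> e' * norm h * P"
      unfolding eventually_nhds_metric dist_norm by auto
    have "norm (G y vs - G x vs - A ((y - x) # vs)) \<le> e * norm (y - x)"
      if "norm (y - x) < d" for y
      using bd[OF that] mult_right_mono[OF e'(2) norm_ge_zero[of "y - x"]]
      by (simp add: algebra_simps)
    with d show "\<exists>d>0. \<forall>y. norm (y - x) < d \<longrightarrow>
        norm (G y vs - G x vs - A ((y - x) # vs)) \<le> e * norm (y - x)"
      by blast
  qed
  from has_derivative_unique[OF *[OF S] *[OF T]] show ?thesis
    by (rule fun_cong)
qed

lemma has_multilinear_derivative_0: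
  fixes F :: "'a::real_normed_vector \<Rightarrow> 'b::real_normed_vector"
  assumes "(F has_derivative A) (at x)"
  shows "has_multilinear_derivative 0 (\<lambda>x vs. F x) (\<lambda>vs. A (hd vs)) x"
proof -
  interpret A: bounded_linear A
    using assms by (rule has_derivative_bounded_linear)
  have "linear (\<lambda>v. A (hd (vs[i := v])))" if "length vs = Suc 0" "i < Suc 0" for vs :: "'a list" and i
    using that A.linear_axioms by (cases vs) auto
  moreover obtain C where "\<And>v. norm (A v) \<le> norm v * C"
    using A.bounded by blast
  then have "norm (A (hd vs)) \<le> C * (\<Prod>v\<leftarrow>vs. norm v)" if "length vs = Suc 0" for vs :: "'a list"
    using that by (cases vs) (auto simp: mult.commute)
  ultimately have "bounded_multilinear (Suc 0) (\<lambda>vs. A (hd vs))"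
    unfolding bounded_multilinear_def by blast
  moreover have "\<forall>\<^sub>F h in nhds 0. norm (F (x + h) - F x - A h) \<le> e * norm h" if e: "e > 0" for e
  proof -
    obtain d where "d > 0"
      and d: "\<And>y. norm (y - x) < d \<Longrightarrow> norm (F y - F x - A (y - x)) \<le> e * norm (y - x)"
      using assms e unfolding has_derivative_at_alt by blast
    then show ?thesis
      unfolding eventually_nhds_metric dist_norm
      using d[of "x + h" for h] by (intro exI[of _ d]) auto
  qed
  ultimately show ?thesis
    by (simp add: has_multilinear_derivative_def)
qed

lemma nth_frechet_derivative_1:
  fixes F :: "'a::real_normed_vector \<Rightarrow> 'b::real_normed_vector"
  assumes "F differentiable (at x)"
  shows "nth_frechet_derivative F 1 x [v] = frechet_derivative F (at x) v"
proof -
  let ?A = "frechet_derivative F (at x)"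
  have A: "has_multilinear_derivative 0 (\<lambda>x vs. F x) (\<lambda>vs. ?A (hd vs)) x"
    using assms by (intro has_multilinear_derivative_0) (simp flip: frechet_derivative_works)
  then have "has_multilinear_derivative 0 (\<lambda>x vs. F x) (nth_frechet_derivative F 1 x) x"
    by (simp add: someI[of "\<lambda>T. has_multilinear_derivative 0 (\<lambda>x vs. F x) T x"])
  from has_multilinear_derivative_unique[OF this A, of "[]" v] show ?thesis
    by simp
qed

lemma nth_frechet_derivative_2:
  fixes F :: "'a::real_normed_vector \<Rightarrow> 'b::real_normed_vector"
    and F' :: "'a \<Rightarrow> 'a \<Rightarrow>\<^sub>L 'b" and F'' :: "'a \<Rightarrow>\<^sub>L 'a \<Rightarrow>\<^sub>L 'b"
  assumes D: "open D" "x \<in> D"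
    and F': "\<And>y. y \<in> D \<Longrightarrow> (F has_derivative blinfun_apply (F' y)) (at y)"
    and F'': "(F' has_derivative blinfun_apply F'') (at x)"
  shows "nth_frechet_derivative F 2 x [u, v] = F'' u v"
proof -
  let ?T = "\<lambda>vs. F'' (vs ! 0) (vs ! 1)"
  have one: "nth_frechet_derivative F 1 y [w] = F' y w" if "y \<in> D" for y w
    using nth_frechet_derivative_1[of F y w] F'[OF that]
    by (metis differentiableI frechet_derivative_at)
  have len1: "length vs = Suc 0 \<longleftrightarrow> (\<exists>w. vs = [w])" for vs :: "'a list"
    by (auto simp: length_Suc_conv)
  have "linear (\<lambda>w. ?T (vs[i := w]))" if len: "length vs = Suc 1" and i: "i < Suc 1" for vs :: "'a list" and i
  proof -
    obtain a b where vs: "vs = [a, b]"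
      using len by (auto simp: length_Suc_conv)
    have "i = 0 \<or> i = 1"
      using i by auto
    then show ?thesis
      by (auto simp: vs linear_iff blinfun.bilinear_simps)
  qed
  moreover have "norm (?T vs) \<le> norm F'' * (\<Prod>v\<leftarrow>vs. norm v)" if len: "length vs = Suc 1" for vs :: "'a list"
  proof -
    obtain a b where vs: "vs = [a, b]"
      using len by (auto simp: length_Suc_conv)
    have "norm (F'' a b) \<le> norm (F'' a) * norm b"
      by (rule norm_blinfun)
    also have "\<dots> \<le> norm F'' * norm a * norm b"
      by (intro mult_right_mono norm_blinfun) auto
    finally show ?thesis
      by (simp add: vs mult.assoc)
  qed
  ultimately have "bounded_multilinear (Suc 1) ?T"
    unfolding bounded_multilinear_def by blast
  moreover have "\<forall>\<^sub>F h in nhds 0. \<forall>vs. length vs = 1 \<longrightarrow>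
      norm (nth_frechet_derivative F 1 (x + h) vs - nth_frechet_derivative F 1 x vs - ?T (h # vs))
        \<le> e * norm h * (\<Prod>v\<leftarrow>vs. norm v)" if e: "e > 0" for e
  proof -
    obtain d where d: "d > 0"
      and bd: "\<And>y. norm (y - x) < d \<Longrightarrow> norm (F' y - F' x - F'' (y - x)) \<le> e * norm (y - x)"
      using F'' e unfolding has_derivative_at_alt by blast
    obtain r where r: "r > 0" and rD: "ball x r \<subseteq> D"
      using D openE by blast
    have "norm (nth_frechet_derivative F 1 (x + h) [w] - nth_frechet_derivative F 1 x [w] - F'' h w)
        \<le> e * norm h * norm w" if h: "norm h < min d r" for h w
    proof -
      have "x + h \<in> D"
        using h rD by (auto simp: dist_norm)
      then have "norm (nth_frechet_derivative F 1 (x + h) [w] - nth_frechet_derivative F 1 x [w] - F'' h w)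
          = norm ((F' (x + h) - F' x - F'' h) w)"
        using D by (simp only: one blinfun.diff_left)
      also have "\<dots> \<le> norm (F' (x + h) - F' x - F'' h) * norm w"
        by (rule norm_blinfun)
      also have "\<dots> \<le> e * norm h * norm w"
        using bd[of "x + h"] h by (intro mult_right_mono) auto
      finally show ?thesis .
    qed
    then show ?thesis
      unfolding eventually_nhds_metric dist_norm using d r
      by (intro exI[of _ "min d r"]) (auto simp: len1)
  qed
  ultimately have T: "has_multilinear_derivative 1 (nth_frechet_derivative F 1) ?T x"
    unfolding has_multilinear_derivative_def by blast
  have "nth_frechet_derivative F 2 x =
      (SOME T. has_multilinear_derivative 1 (nth_frechet_derivative F 1) T x)"
    unfolding numeral_2_eq_2 One_nat_def by (simp only: nth_frechet_derivative.simps)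
  with someI[of "\<lambda>T. has_multilinear_derivative 1 (nth_frechet_derivative F 1) T x", OF T]
  have "has_multilinear_derivative 1 (nth_frechet_derivative F 1) (nth_frechet_derivative F 2 x) x"
    by simp
  from has_multilinear_derivative_unique[OF this T, of "[v]" u] show ?thesis
    by simp
qed

end

theory Submission
  imports Defs
begin

text \<open>
  Put \<open>G = F'(x0)\<^sup>-\<^sup>1 F\<close>.  By the identity theorem along lines, \<open>G\<close> is the sum of its Taylor series
  at \<open>x0\<close> on the whole ball of radius \<open>1 / \<gamma>\<close>; because the derivatives are symmetric, the series
  can be differentiated termwise, which bounds the \<open>j\<close>-th derivative of \<open>G\<close> at \<open>x\<close> by the \<open>j\<close>-th
  derivative of the majorant \<open>f\<close> at \<open>norm (x - x0)\<close> for \<open>j \<ge> 2\<close>.  Writing \<open>d\<close> for the Halley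
  increment at \<open>x\<close>, \<open>n = G'(x)\<^sup>-\<^sup>1 G(x)\<close> and \<open>R\<close> for third order Taylor remainders, one has
  \<open>G(x + d) = G''(x)(L d, d) / 2 + R(d)\<close> and, for a zero \<open>y\<close> and \<open>e = y - x\<close>,
  \<open>(I - L)(e - d) = G'(x)\<^sup>-\<^sup>1 G''(x)(W, e) / 2 - G'(x)\<^sup>-\<^sup>1 R(e)\<close> with
  \<open>W = G'(x)\<^sup>-\<^sup>1 (G''(x)(e, e) / 2 + R(e)) = - n - e\<close>.  The same identities hold for \<open>f\<close> at \<open>t\<close> with
  all terms positive, so each step for \<open>G\<close> is dominated by the step for \<open>f\<close>.
\<close>

section \<open>Symmetry of second derivatives and termwise differentiation\<close>

text \<open>Analyticity gives a Taylor series of unknown radius at each point, whereas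
  \<open>\<gamma>\<close> controls the derivatives at \<open>x0\<close> only; all estimates on the
  ball have to be recovered from these numbers. Up to an affine function, \<open>f\<close> is
  \<open>1 / (\<gamma> * (1 - \<gamma> * t))\<close>, a geometric series whose coefficients are
  exactly the bounds for those of \<open>G\<close>; hence bounds for \<open>G\<close> and values of
  \<open>f\<close> keep the same shape. In the variable \<open>s = 1 - \<gamma> * t\<close>, the
  equation \<open>f t = 0\<close> reads \<open>2 * s\<^sup>2 + (\<alpha> - 3) * s + 1 = 0\<close>;
  that its roots have product \<open>1 / 2\<close> replaces the square roots in all scalar
  inequalities. Uniqueness is separate from the iteration: a zero of \<open>G\<close> at a distance
  strictly between \<open>ts\<close> and \<open>tss\<close> would contradict \<open>f < 0\<close>
  there, and on the closed ball of radius \<open>ts\<close> the map \<open>I - G\<close> is a strict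
  contraction because \<open>f'\<close> is still negative at \<open>ts\<close>. The constant
  \<open>8 / 3\<close> is \<open>2 * (4 / 3)\<close>: the 2 comes from the exact error of a scalar
  step, the \<open>4 / 3\<close> from a polynomial inequality.\<close>

lemma second_difference_bound:
  fixes f :: "'a::real_normed_vector \<Rightarrow> 'b::real_normed_vector"
  assumes D: "open D" "x \<in> D"
    and f1: "\<And>y. y \<in> D \<Longrightarrow> (f has_derivative f1 y) (at y)"
    and A: "((\<lambda>y. f1 y u) has_derivative A) (at x)"
    and e: "e > 0"
  shows "\<exists>d>0. \<forall>s. 0 < s \<and> s < d \<longrightarrow>
    norm (f (x + s *\<^sub>R u + s *\<^sub>R v) - f (x + s *\<^sub>R u) - f (x + s *\<^sub>R v) + f x - s\<^sup>2 *\<^sub>R A v) \<le> e * s\<^sup>2"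
proof -
  interpret A: bounded_linear A
    using A by (rule has_derivative_bounded_linear)
  define M where "M = norm u + norm v + 1"
  have M: "M > 0"
    unfolding M_def by (smt (verit) norm_ge_zero)
  \<comment> \<open>Two remainders, each at most \<open>e1 * (s * M)\<close>, will add up to
    \<open>e * s\<close>.\<close>
  define e1 where "e1 = e / (2 * M)"
  have e1: "e1 > 0" "2 * (e1 * M) = e"
    using e M by (auto simp: e1_def)
  obtain d1 where d1: "d1 > 0"
    and bd: "\<And>y. norm (y - x) < d1 \<Longrightarrow> norm (f1 y u - f1 x u - A (y - x)) \<le> e1 * norm (y - x)"
    using A e1(1) unfolding has_derivative_at_alt by blast
  have bd': "norm (f1 (x + h) u - f1 x u - A h) \<le> e1 * norm h" if "norm h < d1" for h
    using bd[of "x + h"] that by simp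
  obtain r where r: "r > 0" "ball x r \<subseteq> D"
    using D openE by blast
  define d where "d = min d1 r / M"
  have d: "d > 0"
    using d1 r M by (simp add: d_def)
  have "norm (f (x + s *\<^sub>R u + s *\<^sub>R v) - f (x + s *\<^sub>R u) - f (x + s *\<^sub>R v) + f x - s\<^sup>2 *\<^sub>R A v) \<le> e * s\<^sup>2"
    if s: "0 < s" "s < d" for s
  proof -
    \<comment> \<open>\<open>k s - k 0\<close> is the second difference minus
      \<open>s\<^sup>2 *\<^sub>R A v\<close>. Its slope in \<sigma> is a difference of two first
      order remainders of \<open>f1 y u\<close> at \<open>x\<close>, in which \<open>f1 x u\<close>
      cancels; so the mean value inequality along \<open>u\<close> works with differentiability at
      the single point \<open>x\<close>.\<close>
    define k where "k \<sigma> = f (x + \<sigma> *\<^sub>R u + s *\<^sub>R v) - f (x + \<sigma> *\<^sub>R u) - \<sigma> *\<^sub>R (s *\<^sub>R A v)" for \<sigma>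
    have sM: "s * M < d1" "s * M < r"
      using s M d by (auto simp: d_def field_simps)
    have small: "norm (\<sigma> *\<^sub>R u) \<le> s * M" "norm (\<sigma> *\<^sub>R u + s *\<^sub>R v) \<le> s * M" if "\<sigma> \<in> {0..s}" for \<sigma>
    proof -
      have "norm (\<sigma> *\<^sub>R u) \<le> s * norm u"
        using that by (simp add: mult_right_mono)
      then show "norm (\<sigma> *\<^sub>R u) \<le> s * M" "norm (\<sigma> *\<^sub>R u + s *\<^sub>R v) \<le> s * M"
        using s norm_triangle_ineq[of "\<sigma> *\<^sub>R u" "s *\<^sub>R v"] mult_nonneg_nonneg[OF less_imp_le[OF s(1)] norm_ge_zero[of v]]
        unfolding M_def distrib_left norm_scaleR by linarith+
    qed
    define k' where "k' \<sigma> = f1 (x + \<sigma> *\<^sub>R u + s *\<^sub>R v) u - f1 (x + \<sigma> *\<^sub>R u) u - s *\<^sub>R A v" for \<sigma>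
    have "norm (k s - k 0) \<le> (e * s) * norm (s - 0)"
    proof (rule differentiable_bound[where S="{0..s}" and f'="\<lambda>\<sigma> h. h *\<^sub>R k' \<sigma>"])
      fix \<sigma> assume \<sigma>: "\<sigma> \<in> {0..s}"
      have inD: "x + w \<in> D" if "norm w \<le> s * M" for w
        using that sM(2) r(2) by (auto intro!: subsetD[OF r(2)] simp: dist_norm)
      have "x + \<sigma> *\<^sub>R u \<in> D" "x + \<sigma> *\<^sub>R u + s *\<^sub>R v \<in> D"
        using inD small[OF \<sigma>] unfolding add.assoc by blast+
      then have F: "(f has_derivative f1 (x + \<sigma> *\<^sub>R u)) (at (x + \<sigma> *\<^sub>R u))"
        "(f has_derivative f1 (x + \<sigma> *\<^sub>R u + s *\<^sub>R v)) (at (x + \<sigma> *\<^sub>R u + s *\<^sub>R v))"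
        using f1 by auto
      have l: "f1 (x + \<sigma> *\<^sub>R u) (h *\<^sub>R u) = h *\<^sub>R f1 (x + \<sigma> *\<^sub>R u) u"
        "f1 (x + \<sigma> *\<^sub>R u + s *\<^sub>R v) (h *\<^sub>R u) = h *\<^sub>R f1 (x + \<sigma> *\<^sub>R u + s *\<^sub>R v) u" for h
        using F by (auto dest!: has_derivative_bounded_linear bounded_linear.linear simp: linear_cmul)
      have g1: "((\<lambda>\<sigma>. x + \<sigma> *\<^sub>R u) has_derivative (\<lambda>h. h *\<^sub>R u)) (at \<sigma> within {0..s})"
       and g2: "((\<lambda>\<sigma>. x + \<sigma> *\<^sub>R u + s *\<^sub>R v) has_derivative (\<lambda>h. h *\<^sub>R u)) (at \<sigma> within {0..s})"
        by (auto intro!: derivative_eq_intros)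
      have c1: "((\<lambda>\<sigma>. f (x + \<sigma> *\<^sub>R u)) has_derivative (\<lambda>h. h *\<^sub>R f1 (x + \<sigma> *\<^sub>R u) u)) (at \<sigma> within {0..s})"
        using diff_chain_within[OF g1 has_derivative_at_withinI[OF F(1)]] by (simp add: o_def l)
      have c2: "((\<lambda>\<sigma>. f (x + \<sigma> *\<^sub>R u + s *\<^sub>R v)) has_derivative (\<lambda>h. h *\<^sub>R f1 (x + \<sigma> *\<^sub>R u + s *\<^sub>R v) u)) (at \<sigma> within {0..s})"
        using diff_chain_within[OF g2 has_derivative_at_withinI[OF F(2)]] by (simp add: o_def l)
      show "(k has_derivative (\<lambda>h. h *\<^sub>R k' \<sigma>)) (at \<sigma> within {0..s})"
        unfolding k_def
        by (rule derivative_eq_intros c1 c2 refl)+ (auto simp: k'_def algebra_simps)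
      have "k' \<sigma> = (f1 (x + (\<sigma> *\<^sub>R u + s *\<^sub>R v)) u - f1 x u - A (\<sigma> *\<^sub>R u + s *\<^sub>R v))
          - (f1 (x + \<sigma> *\<^sub>R u) u - f1 x u - A (\<sigma> *\<^sub>R u))"
        by (simp add: k'_def A.add A.scaleR algebra_simps)
      also have "norm \<dots> \<le> e1 * norm (\<sigma> *\<^sub>R u + s *\<^sub>R v) + e1 * norm (\<sigma> *\<^sub>R u)"
        using bd'[OF le_less_trans[OF small(2)[OF \<sigma>] sM(1)]] bd'[OF le_less_trans[OF small(1)[OF \<sigma>] sM(1)]]
        by (rule order_trans[OF norm_triangle_ineq4 add_mono])
      also have "\<dots> \<le> e1 * (s * M) + e1 * (s * M)"
        using small[OF \<sigma>] e1 by (intro add_mono mult_left_mono) auto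
      also have "\<dots> = e * s"
        by (simp flip: e1(2))
      finally show "onorm (\<lambda>h. h *\<^sub>R k' \<sigma>) \<le> e * s"
        by (intro onorm_bound) (use e s in \<open>auto simp: mult.commute[of _ "\<bar>_\<bar>"] intro!: mult_left_mono\<close>)
    qed (use s in auto)
    then show ?thesis
      using s by (simp add: k_def power2_eq_square algebra_simps)
  qed
  with d show ?thesis by (intro exI[of _ d]) auto
qed

text \<open>The second difference is symmetric in \<open>u\<close> and \<open>v\<close>, and divided
  by \<open>s\<^sup>2\<close> it tends both to \<open>A v\<close> and to \<open>B u\<close>.\<close>

lemma second_derivative_symmetric:
  fixes f :: "'a::real_normed_vector \<Rightarrow> 'b::real_normed_vector"
  assumes D: "open D" "x \<in> D"
    and f1: "\<And>y. y \<in> D \<Longrightarrow> (f has_derivative f1 y) (at y)"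
    and A: "((\<lambda>y. f1 y u) has_derivative A) (at x)"
    and B: "((\<lambda>y. f1 y v) has_derivative B) (at x)"
  shows "A v = B u"
proof -
  have "norm (A v - B u) \<le> 2 * e" if e: "e > 0" for e
  proof -
    obtain d1 d2 where d: "d1 > 0" "d2 > 0"
      and 1: "\<And>s. 0 < s \<Longrightarrow> s < d1 \<Longrightarrow> norm (f (x + s *\<^sub>R u + s *\<^sub>R v) - f (x + s *\<^sub>R u) - f (x + s *\<^sub>R v) + f x - s\<^sup>2 *\<^sub>R A v) \<le> e * s\<^sup>2"
      and 2: "\<And>s. 0 < s \<Longrightarrow> s < d2 \<Longrightarrow> norm (f (x + s *\<^sub>R v + s *\<^sub>R u) - f (x + s *\<^sub>R v) - f (x + s *\<^sub>R u) + f x - s\<^sup>2 *\<^sub>R B u) \<le> e * s\<^sup>2"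
      using second_difference_bound[OF D f1 A e] second_difference_bound[OF D f1 B e] by metis
    define s where "s = min d1 d2 / 2"
    have s: "0 < s" "s < d1" "s < d2"
      using d by (auto simp: s_def)
    define \<Delta> where "\<Delta> = f (x + s *\<^sub>R u + s *\<^sub>R v) - f (x + s *\<^sub>R u) - f (x + s *\<^sub>R v) + f x"
    have "s\<^sup>2 * norm (A v - B u) = norm ((\<Delta> - s\<^sup>2 *\<^sub>R B u) - (\<Delta> - s\<^sup>2 *\<^sub>R A v))"
      by (simp add: scaleR_diff_right[symmetric])
    also have "\<dots> \<le> e * s\<^sup>2 + e * s\<^sup>2"
    proof (rule order_trans[OF norm_triangle_ineq4 add_mono])
      show "norm (\<Delta> - s\<^sup>2 *\<^sub>R A v) \<le> e * s\<^sup>2"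
        using 1[OF s(1,2)] by (simp only: \<Delta>_def)
      have "\<Delta> = f (x + s *\<^sub>R v + s *\<^sub>R u) - f (x + s *\<^sub>R v) - f (x + s *\<^sub>R u) + f x"
        by (simp add: \<Delta>_def algebra_simps)
      then show "norm (\<Delta> - s\<^sup>2 *\<^sub>R B u) \<le> e * s\<^sup>2"
        using 2[OF s(1,3)] by (simp only:)
    qed
    finally show ?thesis
      using s by (simp add: field_simps)
  qed
  from this[of "norm (A v - B u) / 4"] show ?thesis
    by (cases "A v = B u") auto
qed

text \<open>The M-test makes the differentiated series converge uniformly; convergence of the
  original series at the one point \<open>s0\<close> then suffices.\<close>

lemma has_vector_derivative_series:
  fixes f :: "nat \<Rightarrow> real \<Rightarrow> 'a::banach"
  assumes S: "open S" "convex S" and s0: "s0 \<in> S" "s \<in> S"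
    and f: "\<And>n s. s \<in> S \<Longrightarrow> (f n has_vector_derivative f' n s) (at s)"
    and M: "\<And>n s. s \<in> S \<Longrightarrow> norm (f' n s) \<le> M n" "summable M"
    and sm: "summable (\<lambda>n. f n s0)"
  shows "((\<lambda>s. \<Sum>n. f n s) has_vector_derivative (\<Sum>n. f' n s)) (at s)"
proof -
  have u: "uniform_limit S (\<lambda>n s. \<Sum>i<n. f' i s) (\<lambda>s. \<Sum>i. f' i s) sequentially"
    by (rule Weierstrass_m_test) (use M in auto)
  have "\<exists>g. \<forall>x\<in>S. (\<lambda>n. f n x) sums g x \<and>
      (g has_derivative (\<lambda>h. h *\<^sub>R (\<Sum>i. f' i x))) (at x within S)"
  proof (rule has_derivative_series[where f'="\<lambda>n s h. h *\<^sub>R f' n s" and g'="\<lambda>x h. h *\<^sub>R (\<Sum>i. f' i x)" and x=s0 and f=f and S=S and l="\<Sum>n. f n s0"])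
    show "convex S" "s0 \<in> S" "(\<lambda>n. f n s0) sums (\<Sum>n. f n s0)"
      using S s0 sm by (auto intro: summable_sums)
  next
    fix n x assume "x \<in> S"
    then show "(f n has_derivative (\<lambda>h. h *\<^sub>R f' n x)) (at x within S)"
      by (rule has_derivative_at_withinI[OF f[unfolded has_vector_derivative_def]])
  next
    fix e :: real assume e: "e > 0"
    show "\<forall>\<^sub>F n in sequentially. \<forall>x\<in>S. \<forall>h. norm ((\<Sum>i<n. h *\<^sub>R f' i x) - h *\<^sub>R (\<Sum>i. f' i x)) \<le> e * norm h"
      using uniform_limitD[OF u e]
    proof (rule eventually_mono, intro ballI allI)
      fix n x h assume *: "\<forall>x\<in>S. dist (\<Sum>i<n. f' i x) (\<Sum>i. f' i x) < e" and x: "x \<in> S"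
      have "norm ((\<Sum>i<n. h *\<^sub>R f' i x) - h *\<^sub>R (\<Sum>i. f' i x)) = norm h * norm ((\<Sum>i<n. f' i x) - (\<Sum>i. f' i x))"
        by (simp flip: scaleR_right.sum scaleR_diff_right)
      also have "\<dots> \<le> norm h * e"
        using * x by (intro mult_left_mono) (auto simp: dist_norm intro: less_imp_le)
      finally show "norm ((\<Sum>i<n. h *\<^sub>R f' i x) - h *\<^sub>R (\<Sum>i. f' i x)) \<le> e * norm h"
        by (simp add: mult.commute)
    qed
  qed
  then obtain g where g': "\<forall>x\<in>S. (\<lambda>n. f n x) sums g x \<and>
      (g has_derivative (\<lambda>h. h *\<^sub>R (\<Sum>i. f' i x))) (at x within S)"
    by (rule exE)
  have g: "(\<lambda>n. f n x) sums g x"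
      "(g has_derivative (\<lambda>h. h *\<^sub>R (\<Sum>i. f' i x))) (at x within S)" if "x \<in> S" for x
    using bspec[OF g' that] by auto
  have "(g has_vector_derivative (\<Sum>i. f' i s)) (at s)"
    using g(2)[OF s0(2)] unfolding has_vector_derivative_def at_within_open[OF s0(2) S(1)] .
  then show ?thesis
    by (rule has_vector_derivative_transform_within_open[OF _ S(1) s0(2) sums_unique[OF g(1)]])
qed

text \<open>Binomial series with exponent \<open>- (n + 1)\<close>, that is, the geometric series
  differentiated \<open>n\<close> times and divided by \<open>fact n\<close>. It sums the
  coefficient bounds of every termwise differentiated Taylor series below.\<close>

lemma negative_binomial_sums:
  fixes z :: real
  assumes "\<bar>z\<bar> < 1"
  shows "(\<lambda>k. real ((k + n) choose n) * z ^ k) sums (1 / (1 - z) ^ Suc n)"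
proof -
  have "(\<lambda>k. ((- real (Suc n)) gchoose k) * (- z) ^ k) sums (1 + - z) powr (- real (Suc n))"
    by (rule gen_binomial_real) (use assms in auto)
  moreover have "((- real (Suc n)) gchoose k) * (- z) ^ k = real ((k + n) choose n) * z ^ k" for k
  proof -
    have "(- real (Suc n)) gchoose k = (-1) ^ k * (real (n + k) gchoose k)"
      by (subst gbinomial_minus) (simp add: algebra_simps)
    also have "real (n + k) gchoose k = real ((k + n) choose n)"
      using binomial_symmetric[of k "n + k"] binomial_gbinomial[of "n + k" k, where 'a=real]
      by (simp add: add.commute)
    finally show ?thesis
      by (simp add: power_minus[of z])
  qed
  moreover have "(1 + - z) powr (- real (Suc n)) = 1 / (1 - z) ^ Suc n"
    using assms by (simp add: powr_minus_divide powr_realpow del: of_nat_Suc)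
  ultimately show ?thesis
    by (simp only:)
qed

lemma fact_ratio: "fact (k + n) / fact k = (fact n * real ((k + n) choose n) :: real)"
  by (simp add: binomial_fact)

section \<open>Taylor series on a real interval\<close>

text \<open>The bound on \<open>Df p\<close> is the \<open>p\<close>-th derivative of
  \<open>C / (1 - q * t)\<close>. Both remainders have the same nonnegative integral kernel, so the
  one of \<open>Df\<close> is dominated by that of the scalar function, which is a tail of a
  geometric series.\<close>

lemma taylor_majorant:
  fixes Df :: "nat \<Rightarrow> real \<Rightarrow> 'a::banach"
  assumes p: "p > 0" and q: "0 \<le> q" "q < 1"
    and Df: "\<And>n t. n < p \<Longrightarrow> t \<in> {0..1} \<Longrightarrow> (Df n has_vector_derivative Df (Suc n) t) (at t within {0..1})"
    and bd: "\<And>t. t \<in> {0..1} \<Longrightarrow> norm (Df p t) \<le> C * fact p * q ^ p / (1 - q * t) ^ Suc p"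
  shows "norm (Df 0 1 - (\<Sum>n<p. Df n 0 /\<^sub>R fact n)) \<le> C * q ^ p / (1 - q)"
proof -
  define Dg where "Dg n t = C * fact n * q ^ n / (1 - q * t) ^ Suc n" for n and t :: real
  define w where "w t = (1 - t) ^ (p - 1) / fact (p - 1)" for t :: real
  have pos: "1 - q * t > 0" if "t \<in> {0..1}" for t
    using that q mult_left_mono[of t 1 q] by auto
  have Dg: "(Dg n has_vector_derivative Dg (Suc n) t) (at t within {0..1})" if "t \<in> {0..1}" for n t
  proof -
    have "((\<lambda>t. inverse (1 - q * t)) has_real_derivative q * inverse (1 - q * t) ^ 2) (at t within {0..1})"
      using pos[OF that] by (auto intro!: derivative_eq_intros simp: power2_eq_square)
    from DERIV_cmult[OF DERIV_power_Suc[OF this], of "C * fact n * q ^ n" n]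
    have "((\<lambda>t. C * fact n * q ^ n * inverse (1 - q * t) ^ Suc n) has_real_derivative Dg (Suc n) t) (at t within {0..1})"
      by (rule DERIV_cong) (simp add: Dg_def divide_inverse power_inverse power2_eq_square)
    moreover have "Dg n = (\<lambda>t. C * fact n * q ^ n * inverse (1 - q * t) ^ Suc n)"
      by (simp add: Dg_def fun_eq_iff divide_inverse power_inverse)
    ultimately show ?thesis
      by (simp only: has_real_derivative_iff_has_vector_derivative)
  qed
  have 1: "((\<lambda>t. w t *\<^sub>R Df p t) has_integral
      Df 0 1 - (\<Sum>n<p. ((1 - 0) ^ n / fact n) *\<^sub>R Df n 0)) {0..1}"
    unfolding w_def by (rule Taylor_has_integral[OF p refl]) (use Df in auto)
  have 2: "((\<lambda>t. w t *\<^sub>R Dg p t) has_integral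
      Dg 0 1 - (\<Sum>n<p. ((1 - 0) ^ n / fact n) *\<^sub>R Dg n 0)) {0..1}"
    unfolding w_def by (rule Taylor_has_integral[OF p refl]) (use Dg in auto)
  have "norm (w t *\<^sub>R Df p t) \<le> w t *\<^sub>R Dg p t" if "t \<in> {0..1}" for t
  proof -
    have "w t \<ge> 0"
      using that by (simp add: w_def)
    moreover have "norm (Df p t) \<le> Dg p t"
      unfolding Dg_def using bd[OF that] .
    ultimately show ?thesis
      by (simp add: mult_left_mono)
  qed
  then have "norm (Df 0 1 - (\<Sum>n<p. ((1 - 0) ^ n / fact n) *\<^sub>R Df n 0))
      \<le> Dg 0 1 - (\<Sum>n<p. ((1 - 0) ^ n / fact n) *\<^sub>R Dg n 0)"
    using integral_norm_bound_integral[of "\<lambda>t. w t *\<^sub>R Df p t" "{0..1}" "\<lambda>t. w t *\<^sub>R Dg p t"]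
    using has_integral_integrable[OF 1] has_integral_integrable[OF 2]
      integral_unique[OF 1] integral_unique[OF 2] by simp
  also have "(\<Sum>n<p. ((1 - 0) ^ n / fact n) *\<^sub>R Dg n 0) = C * (\<Sum>n<p. q ^ n)"
    by (simp add: Dg_def sum_distrib_left)
  also have "Dg 0 1 - C * (\<Sum>n<p. q ^ n) = C * q ^ p / (1 - q)"
  proof -
    have "Dg 0 1 - C * (\<Sum>n<p. q ^ n) = C * 1 / (1 - q) - C * (1 - q ^ p) / (1 - q)"
      using q by (simp add: Dg_def sum_gp_strict)
    also have "\<dots> = C * q ^ p / (1 - q)"
      by (simp only: diff_divide_distrib[symmetric] right_diff_distrib[symmetric]) simp
    finally show ?thesis .
  qed
  finally show ?thesis
    by (simp add: divide_inverse)
qed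

lemma has_vector_derivative_power_term:
  fixes c :: "'a::real_normed_vector"
  shows "((\<lambda>s. (s ^ Suc k / fact (Suc k)) *\<^sub>R c) has_vector_derivative (s ^ k / fact k) *\<^sub>R c) (at s)"
proof -
  have "((\<lambda>s. s ^ Suc k / fact (Suc k)) has_real_derivative s ^ k / fact k) (at s)"
    by (auto intro!: derivative_eq_intros simp: divide_simps simp del: power_Suc of_nat_Suc)
  then have "((\<lambda>s. (s ^ Suc k / fact (Suc k)) *\<^sub>R c) has_vector_derivative
      (s ^ Suc k / fact (Suc k)) *\<^sub>R 0 + (s ^ k / fact k) *\<^sub>R c) (at s)"
    by (rule has_vector_derivative_scaleR) simp
  then show ?thesis
    by simp
qed

text \<open>Identity theorem for vector-valued functions on an interval: the bounds at 0 make the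
  formal Taylor series at 0 converge on all of \<open>(-R, R)\<close>, and its sum
  \<open>\<psi> 0\<close> is again locally a Taylor series. The points where \<phi> and \<psi> agree
  to all orders form a clopen set containing 0.\<close>

lemma taylor_sums_global:
  fixes \<phi> :: "nat \<Rightarrow> real \<Rightarrow> 'a::banach"
  assumes q: "0 \<le> q" "q * R \<le> 1"
    and der: "\<And>n s. \<bar>s\<bar> < R \<Longrightarrow> (\<phi> n has_vector_derivative \<phi> (Suc n) s) (at s)"
    and taylor: "\<And>s. \<bar>s\<bar> < R \<Longrightarrow> \<exists>\<delta>>0. \<forall>\<sigma>. \<bar>\<sigma>\<bar> < \<delta> \<longrightarrow> (\<lambda>k. (\<sigma> ^ k / fact k) *\<^sub>R \<phi> k s) sums \<phi> 0 (s + \<sigma>)"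
    and bd: "\<And>k. norm (\<phi> k 0) \<le> C * fact k * q ^ k"
    and s: "\<bar>s\<bar> < R"
  shows "(\<lambda>k. (s ^ k / fact k) *\<^sub>R \<phi> k 0) sums \<phi> 0 s"
proof -
  define S where "S = {-R<..<R}"
  have S: "s \<in> S \<longleftrightarrow> \<bar>s\<bar> < R" for s
    by (auto simp: S_def)
  define T where "T n k s = (s ^ k / fact k) *\<^sub>R \<phi> (k + n) 0" for n k and s :: real
  define \<psi> where "\<psi> n s = (\<Sum>k. T n k s)" for n s
  define b where "b n r k = C * fact n * q ^ n * (real ((k + n) choose n) * (q * r) ^ k)" for n r k
  have q1: "q * \<bar>s\<bar> < 1" if "\<bar>s\<bar> < R" for s
    using that q by (cases "q = 0") (auto intro: less_le_trans[OF mult_strict_left_mono])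
  have b_sums: "b n \<bar>s\<bar> sums (C * fact n * q ^ n * (1 / (1 - q * \<bar>s\<bar>) ^ Suc n))" if "\<bar>s\<bar> < R" for n s
    unfolding b_def using q1[OF that] q(1)
    by (intro sums_mult negative_binomial_sums) (auto simp: abs_mult)
  have C: "C \<ge> 0"
    using order_trans[OF norm_ge_zero bd[of 0]] by simp
  have T_le: "norm (T n k s) \<le> b n r k" if "\<bar>s\<bar> \<le> r" for n k s r
  proof -
    have "norm (T n k s) = \<bar>s\<bar> ^ k / fact k * norm (\<phi> (k + n) 0)"
      by (simp add: T_def power_abs)
    also have "\<dots> \<le> r ^ k / fact k * (C * fact (k + n) * q ^ (k + n))"
      using that by (intro mult_mono divide_right_mono power_mono bd) auto
    also have "\<dots> = C * (fact (k + n) / fact k) * q ^ n * (q * r) ^ k"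
      by (simp add: power_add power_mult_distrib)
    also have "\<dots> = b n r k"
      unfolding fact_ratio b_def by (simp add: ac_simps)
    finally show ?thesis .
  qed
  have T_summable: "summable (\<lambda>k. T n k s)" if "\<bar>s\<bar> < R" for n s
    by (rule summable_comparison_test'[OF sums_summable[OF b_sums[OF that]] T_le]) auto
  have \<psi>_le: "norm (\<psi> n s) \<le> C * fact n * q ^ n * (1 / (1 - q * \<bar>s\<bar>) ^ Suc n)" if "\<bar>s\<bar> < R" for n s
    unfolding \<psi>_def sums_unique[OF b_sums[OF that]]
    by (rule norm_suminf_le[OF T_le sums_summable[OF b_sums[OF that]]]) auto
  have \<psi>_der: "(\<psi> n has_vector_derivative \<psi> (Suc n) s) (at s)" if s: "\<bar>s\<bar> < R" for n s
  proof -
    \<comment> \<open>The M-test needs a bound uniform in \<open>s\<close>, available only on an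
      interval strictly inside \<open>(-R, R)\<close>.\<close>
    obtain r where r: "\<bar>s\<bar> < r" "r < R"
      using dense[OF s] by auto
    \<comment> \<open>Term \<open>k\<close> differentiates to term \<open>k - 1\<close> of the next
      series; the constant term contributes 0.\<close>
    define f' where "f' k s = (case k of 0 \<Rightarrow> 0 | Suc k \<Rightarrow> T (Suc n) k s)" for k s
    have "((\<lambda>s. \<Sum>k. T n k s) has_vector_derivative (\<Sum>k. f' k s)) (at s)"
    proof (rule has_vector_derivative_series[where S="{-r<..<r}" and s0=s
          and M="\<lambda>k. case k of 0 \<Rightarrow> 0 | Suc k \<Rightarrow> b (Suc n) r k"])
      show "(T n k has_vector_derivative f' k s) (at s)" for k s
      proof -
        have T: "T n k = (\<lambda>s. (s ^ k / fact k) *\<^sub>R \<phi> (k + n) 0)"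
          by (simp add: T_def fun_eq_iff)
        show ?thesis
          unfolding T using has_vector_derivative_power_term[of "k - 1" "\<phi> (k + n) 0" s]
          by (cases k) (auto simp: f'_def T_def)
      qed
      show "norm (f' k s) \<le> (case k of 0 \<Rightarrow> 0 | Suc k \<Rightarrow> b (Suc n) r k)" if "s \<in> {-r<..<r}" for k s
        using that T_le[of s r] by (auto simp: f'_def split: nat.split)
      show "summable (\<lambda>k. case k of 0 \<Rightarrow> 0 | Suc k \<Rightarrow> b (Suc n) r k)"
        using sums_summable[OF b_sums[of r "Suc n"]] r
        by (subst summable_Suc_iff[symmetric]) auto
      show "summable (\<lambda>k. T n k s)"
        by (rule T_summable[OF s])
    qed (use r in auto)
    also have "(\<Sum>k. f' k s) = \<psi> (Suc n) s"
    proof -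
      have "(\<lambda>k. f' (Suc k) s) sums \<psi> (Suc n) s"
        unfolding \<psi>_def f'_def using summable_sums[OF T_summable[OF s]] by simp
      from sums_unique[OF sums_Suc[OF this]] show ?thesis
        by (simp add: f'_def)
    qed
    finally show ?thesis
      unfolding \<psi>_def .
  qed
  have \<psi>_taylor: "\<exists>\<delta>>0. \<forall>\<sigma>. \<bar>\<sigma>\<bar> < \<delta> \<longrightarrow> (\<lambda>k. (\<sigma> ^ k / fact k) *\<^sub>R \<psi> k s) sums \<psi> 0 (s + \<sigma>)"
    if s: "\<bar>s\<bar> < R" for s
  proof -
    \<comment> \<open>Recentred at \<open>s\<close>, the majorant \<open>C / (1 - q * r)\<close>
      becomes \<open>(C / a) / (1 - q' * t)\<close> with ratio
      \<open>q' = q * \<bar>\<sigma>\<bar> / a\<close>. The choice of \<delta> below forces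
      \<open>q' < 1\<close>; its denominator \<open>q + 1\<close> also covers
      \<open>q = 0\<close>.\<close>
    define a where "a = 1 - q * \<bar>s\<bar>"
    have a: "a > 0"
      using q1[OF s] by (simp add: a_def)
    define \<delta> where "\<delta> = min (R - \<bar>s\<bar>) (a / (q + 1))"
    have \<delta>: "\<delta> > 0"
      using s a q by (auto simp: \<delta>_def)
    have "(\<lambda>k. (\<sigma> ^ k / fact k) *\<^sub>R \<psi> k s) sums \<psi> 0 (s + \<sigma>)" if \<sigma>: "\<bar>\<sigma>\<bar> < \<delta>" for \<sigma>
    proof -
      define q' where "q' = q * \<bar>\<sigma>\<bar> / a"
      have "(q + 1) * \<bar>\<sigma>\<bar> < a"
        using \<sigma> q by (simp add: \<delta>_def field_simps)
      then have q': "0 \<le> q'" "q' < 1"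
        using q a by (simp_all add: q'_def field_simps)
      define Df where "Df n t = \<sigma> ^ n *\<^sub>R \<psi> n (s + t * \<sigma>)" for n t
      have inS: "\<bar>s\<bar> + t * \<bar>\<sigma>\<bar> < R" "\<bar>s + t * \<sigma>\<bar> \<le> \<bar>s\<bar> + t * \<bar>\<sigma>\<bar>" if "t \<in> {0..1}" for t
      proof -
        have "t * \<bar>\<sigma>\<bar> \<le> 1 * \<bar>\<sigma>\<bar>"
          using that by (intro mult_right_mono) auto
        then show "\<bar>s\<bar> + t * \<bar>\<sigma>\<bar> < R"
          using \<sigma> by (simp add: \<delta>_def)
        show "\<bar>s + t * \<sigma>\<bar> \<le> \<bar>s\<bar> + t * \<bar>\<sigma>\<bar>"
          using that abs_triangle_ineq[of s "t * \<sigma>"] by (simp add: abs_mult)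
      qed
      have "norm (\<psi> 0 (s + \<sigma>) - (\<Sum>n<p. (\<sigma> ^ n / fact n) *\<^sub>R \<psi> n s)) \<le> (C / a) * q' ^ p / (1 - q')"
        if p: "p > 0" for p
      proof -
        have "norm (Df 0 1 - (\<Sum>n<p. Df n 0 /\<^sub>R fact n)) \<le> (C / a) * q' ^ p / (1 - q')"
        proof (rule taylor_majorant[OF p q'])
          fix n and t :: real assume t: "t \<in> {0..1}"
          have "((\<lambda>t. \<psi> n (s + t * \<sigma>)) has_vector_derivative \<sigma> *\<^sub>R \<psi> (Suc n) (s + t * \<sigma>)) (at t within {0..1})"
          proof (rule vector_diff_chain_within[of "\<lambda>t. s + t * \<sigma>" \<sigma> t _ "\<psi> n", unfolded o_def])
            show "((\<lambda>t. s + t * \<sigma>) has_vector_derivative \<sigma>) (at t within {0..1})"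
              by (auto intro!: derivative_eq_intros)
            show "(\<psi> n has_vector_derivative \<psi> (Suc n) (s + t * \<sigma>)) (at (s + t * \<sigma>) within (\<lambda>t. s + t * \<sigma>) ` {0..1})"
              by (rule has_vector_derivative_at_within[OF \<psi>_der]) (use inS[OF t] in auto)
          qed
          from has_vector_derivative_scaleR[OF DERIV_const[of "\<sigma> ^ n"] this]
          show "(Df n has_vector_derivative Df (Suc n) t) (at t within {0..1})"
            unfolding Df_def by (simp add: mult.commute)
        next
          fix t :: real assume t: "t \<in> {0..1}"
          have pos: "1 - q' * t > 0"
            using q' t mult_left_mono[of t 1 q'] by auto
          have eq: "1 - q * (\<bar>s\<bar> + t * \<bar>\<sigma>\<bar>) = a * (1 - q' * t)"
            using a by (simp add: q'_def a_def field_simps)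
          have "norm (Df p t) = \<bar>\<sigma>\<bar> ^ p * norm (\<psi> p (s + t * \<sigma>))"
            by (simp add: Df_def power_abs)
          also have "\<dots> \<le> \<bar>\<sigma>\<bar> ^ p * (C * fact p * q ^ p * (1 / (1 - q * \<bar>s + t * \<sigma>\<bar>) ^ Suc p))"
            using inS[OF t] by (intro mult_left_mono \<psi>_le) auto
          also have "\<dots> \<le> \<bar>\<sigma>\<bar> ^ p * (C * fact p * q ^ p * (1 / (1 - q * (\<bar>s\<bar> + t * \<bar>\<sigma>\<bar>)) ^ Suc p))"
          proof -
            have "1 - q * (\<bar>s\<bar> + t * \<bar>\<sigma>\<bar>) > 0"
              unfolding eq using a pos by simp
            moreover have "1 - q * (\<bar>s\<bar> + t * \<bar>\<sigma>\<bar>) \<le> 1 - q * \<bar>s + t * \<sigma>\<bar>"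
              using inS[OF t] q by (simp add: mult_left_mono)
            ultimately show ?thesis
              using C q by (intro mult_left_mono divide_left_mono power_mono mult_pos_pos zero_less_power) auto
          qed
          also have "\<dots> = C / a * fact p * q' ^ p / (1 - q' * t) ^ Suc p"
          proof -
            have "q' ^ p = q ^ p * \<bar>\<sigma>\<bar> ^ p / a ^ p"
              by (simp add: q'_def power_divide power_mult_distrib)
            then show ?thesis
              unfolding eq by (simp add: power_mult_distrib mult_ac)
          qed
          finally show "norm (Df p t) \<le> C / a * fact p * q' ^ p / (1 - q' * t) ^ Suc p" .
        qed
        then show ?thesis
          by (simp add: Df_def field_simps)
      qed
      then have "\<forall>\<^sub>F p in sequentially. norm ((\<Sum>n<p. (\<sigma> ^ n / fact n) *\<^sub>R \<psi> n s) - \<psi> 0 (s + \<sigma>)) \<le> (C / a) * q' ^ p / (1 - q')"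
        by (intro eventually_mono[OF eventually_gt_at_top[of 0]]) (subst norm_minus_commute)
      moreover have "(\<lambda>p. (C / a) * q' ^ p / (1 - q')) \<longlonglongrightarrow> (C / a) * 0 / (1 - q')"
        using q' by (intro tendsto_intros LIMSEQ_realpow_zero) auto
      ultimately show ?thesis
        unfolding sums_def by (subst LIM_zero_iff[symmetric]) (auto intro: Lim_null_comparison)
    qed
    with \<delta> show ?thesis by blast
  qed
  \<comment> \<open>Agreement of all orders is demanded at once, since only the full list of
    derivatives at a point determines the local Taylor series. Near such a point order 0 agrees by
    that series, and the higher orders follow by differentiating the equality.\<close>
  define E where "E = (\<Inter>k. {s \<in> S. \<phi> k s - \<psi> k s = 0})"
  have conn: "connected S" and opS: "open S"
    by (auto simp: S_def)
  have "continuous_on S (\<lambda>s. \<phi> k s - \<psi> k s)" for k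
    by (intro continuous_on_diff continuous_at_imp_continuous_on ballI
        has_vector_derivative_continuous[OF der] has_vector_derivative_continuous[OF \<psi>_der]) (auto simp: S)
  then have "closedin (top_of_set S) E"
    unfolding E_def by (intro closedin_INT continuous_closedin_preimage_constant) auto
  moreover have "openin (top_of_set S) E"
    unfolding openin_open_eq[OF opS]
  proof
    show "E \<subseteq> S"
      by (auto simp: E_def)
    show "open E"
      unfolding open_dist
    proof
      fix s assume "s \<in> E"
      then have s: "\<bar>s\<bar> < R" "\<And>k. \<phi> k s = \<psi> k s"
        by (auto simp: E_def S)
      obtain d1 where 1: "d1 > 0 \<and> (\<forall>\<sigma>. \<bar>\<sigma>\<bar> < d1 \<longrightarrow> (\<lambda>k. (\<sigma> ^ k / fact k) *\<^sub>R \<phi> k s) sums \<phi> 0 (s + \<sigma>))"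
        using taylor[OF s(1)] by (rule exE)
      obtain d2 where 2: "d2 > 0 \<and> (\<forall>\<sigma>. \<bar>\<sigma>\<bar> < d2 \<longrightarrow> (\<lambda>k. (\<sigma> ^ k / fact k) *\<^sub>R \<psi> k s) sums \<psi> 0 (s + \<sigma>))"
        using \<psi>_taylor[OF s(1)] by (rule exE)
      have d: "d1 > 0" "d2 > 0"
        using 1 2 by auto
      define B where "B = ball s (min (min d1 d2) (R - \<bar>s\<bar>))"
      have B: "open B" "\<And>y. y \<in> B \<Longrightarrow> \<bar>y\<bar> < R"
        by (auto simp: B_def dist_real_def)
      have eq: "\<forall>y\<in>B. \<phi> k y = \<psi> k y" for k
      proof (induction k)
        case 0
        show ?case
        proof
          fix y assume "y \<in> B"
          then have "\<bar>y - s\<bar> < d1" "\<bar>y - s\<bar> < d2"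
            by (auto simp: B_def dist_real_def)
          then have "(\<lambda>k. ((y - s) ^ k / fact k) *\<^sub>R \<psi> k s) sums \<phi> 0 (s + (y - s))"
            "(\<lambda>k. ((y - s) ^ k / fact k) *\<^sub>R \<psi> k s) sums \<psi> 0 (s + (y - s))"
            using 1 2 unfolding s(2) by auto
          from sums_unique2[OF this] show "\<phi> 0 y = \<psi> 0 y"
            by simp
        qed
      next
        case (Suc k)
        show ?case
        proof
          fix y assume y: "y \<in> B"
          have "(\<psi> k has_vector_derivative \<phi> (Suc k) y) (at y)"
            by (rule has_vector_derivative_transform_within_open[OF der B(1) y])
              (use B(2) y Suc in auto)
          then show "\<phi> (Suc k) y = \<psi> (Suc k) y"
            using \<psi>_der[OF B(2)[OF y]] by (rule vector_derivative_unique_at)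
        qed
      qed
      have "B \<subseteq> E"
        using eq B(2) by (auto simp: E_def S)
      moreover have "min (min d1 d2) (R - \<bar>s\<bar>) > 0"
        using d s by auto
      ultimately show "\<exists>e>0. \<forall>y. dist y s < e \<longrightarrow> y \<in> E"
        unfolding B_def by (intro exI[of _ "min (min d1 d2) (R - \<bar>s\<bar>)"]) (auto simp: dist_commute)
    qed
  qed
  moreover have "0 \<in> E"
  proof -
    have "T n k 0 = (if k = 0 then \<phi> n 0 else 0)" for n k
      by (auto simp: T_def)
    then have "\<psi> n 0 = \<phi> n 0" for n
      unfolding \<psi>_def using sums_unique[OF sums_single[of 0 "\<lambda>_. \<phi> n 0"]] by simp
    then show ?thesis
      using s by (auto simp: E_def S)
  qed
  ultimately have "E = S"
    using conn unfolding connected_clopen by blast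
  then have "s \<in> E"
    using s S by blast
  then have "\<phi> 0 s = \<psi> 0 s"
    by (auto simp: E_def)
  then show ?thesis
    using summable_sums[OF T_summable[OF s, of 0]] by (simp add: \<psi>_def T_def)
qed

section \<open>Families of iterated derivatives\<close>

lemma norm_sums_le:
  fixes f :: "nat \<Rightarrow> 'a::banach"
  assumes "f sums a" "g sums b" "\<And>k. norm (f k) \<le> g k"
  shows "norm a \<le> b"
  using norm_suminf_le[OF assms(3) sums_summable[OF assms(2)]] assms(1,2) by (simp add: sums_iff)

text \<open>
  \<open>T n x\<close> plays the role of the \<open>n\<close>-th derivative at \<open>x\<close>; the most recent increment is the first
  argument.
\<close>

locale derivative_family =
  fixes T :: "nat \<Rightarrow> 'a::banach \<Rightarrow> 'a list \<Rightarrow> 'b::banach" and D :: "'a set"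
  assumes open_D: "open D"
    and derivative: "x \<in> D \<Longrightarrow> length vs = n \<Longrightarrow>
      ((\<lambda>y. T n y vs) has_derivative (\<lambda>h. T (Suc n) x (h # vs))) (at x)"
    and taylor: "x \<in> D \<Longrightarrow> \<exists>r>0. \<forall>h. norm h < r \<longrightarrow>
      (\<lambda>k. T k x (replicate k h) /\<^sub>R fact k) sums T 0 (x + h) []"
begin

text \<open>If the two arguments stand in front, they are the two latest increments, and the
  symmetry of second derivatives of \<open>T (length ws) y ws\<close> applies. A longer prefix is
  reached by differentiating the identity, which the induction provides on the whole open set
  \<open>D\<close>, in the direction \<open>a\<close>.\<close>

lemma swap:
  assumes "x \<in> D" "length us + length ws + 2 = n"
  shows "T n x (us @ u # v # ws) = T n x (us @ v # u # ws)"
  using assms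
proof (induction us arbitrary: x n)
  case Nil
  have "T (Suc (Suc (length ws))) x (v # u # ws) = T (Suc (Suc (length ws))) x (u # v # ws)"
    by (rule second_derivative_symmetric[OF open_D Nil(1), where f="\<lambda>y. T (length ws) y ws"])
      (auto intro!: derivative Nil)
  with Nil show ?case
    by auto
next
  case (Cons a us)
  define m where "m = length us + length ws + 2"
  have n: "n = Suc m"
    using Cons.prems by (simp add: m_def)
  have "((\<lambda>y. T m y (us @ u # v # ws)) has_derivative (\<lambda>h. T n x (h # us @ u # v # ws))) (at x)"
    unfolding n using Cons.prems by (intro derivative) (auto simp: m_def)
  then have "((\<lambda>y. T m y (us @ v # u # ws)) has_derivative (\<lambda>h. T n x (h # us @ u # v # ws))) (at x)"
    by (rule has_derivative_transform_within_open[OF _ open_D Cons.prems(1)])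
      (use Cons.IH[of _ m] in \<open>auto simp: m_def\<close>)
  moreover have "((\<lambda>y. T m y (us @ v # u # ws)) has_derivative (\<lambda>h. T n x (h # us @ v # u # ws))) (at x)"
    unfolding n using Cons.prems by (intro derivative) (auto simp: m_def)
  ultimately have "(\<lambda>h. T n x (h # us @ u # v # ws)) = (\<lambda>h. T n x (h # us @ v # u # ws))"
    by (rule has_derivative_unique)
  from fun_cong[OF this, of a] show ?case
    by simp
qed

text \<open>Linearity is known directly only in the first slot, where the newest increment enters;
  other slots are brought there by adjacent transpositions.\<close>

lemma move_front:
  assumes "x \<in> D" "length us + length ws + 1 = n"
  shows "T n x (us @ u # ws) = T n x (u # us @ ws)"
  using assms
proof (induction us arbitrary: ws rule: rev_induct)
  case (snoc a us)
  have "T n x (us @ a # u # ws) = T n x (us @ u # a # ws)"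
    using snoc.prems by (intro swap) auto
  also have "\<dots> = T n x (u # us @ a # ws)"
    using snoc.prems by (intro snoc.IH) auto
  finally show ?case by simp
qed auto

lemma linear_first:
  assumes "x \<in> D" "Suc (length vs) = n"
  shows "bounded_linear (\<lambda>v. T n x (v # vs))"
  using has_derivative_bounded_linear[OF derivative[OF assms(1) refl]] assms(2) by metis

lemma linear_slot:
  assumes "x \<in> D" "length us + length vs + 1 = n"
  shows "T n x (us @ (a + c *\<^sub>R b) # vs) = T n x (us @ a # vs) + c *\<^sub>R T n x (us @ b # vs)"
proof -
  interpret bounded_linear "\<lambda>v. T n x (v # us @ vs)"
    using assms by (intro linear_first) auto
  show ?thesis
    using assms by (simp add: move_front add scaleR)
qed

lemma scale_replicate:
  assumes "x \<in> D" "k + length vs = n"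
  shows "T n x (replicate k (c *\<^sub>R h) @ vs) = c ^ k *\<^sub>R T n x (replicate k h @ vs)"
  using assms(2)
proof (induction k arbitrary: vs)
  case (Suc k)
  interpret bounded_linear "\<lambda>v. T n x (v # replicate k h @ vs)"
    using assms(1) Suc.prems by (intro linear_first) auto
  have "T n x (replicate (Suc k) (c *\<^sub>R h) @ vs) = T n x (replicate k (c *\<^sub>R h) @ (c *\<^sub>R h) # vs)"
    by (simp add: replicate_app_Cons_same)
  also have "\<dots> = c ^ k *\<^sub>R T n x (replicate k h @ (c *\<^sub>R h) # vs)"
    using Suc.prems by (intro Suc.IH) auto
  also have "T n x (replicate k h @ (c *\<^sub>R h) # vs) = T n x ((c *\<^sub>R h) # replicate k h @ vs)"
    using assms(1) Suc.prems by (intro move_front) auto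
  finally show ?case
    by (simp add: scaleR mult.commute)
qed simp

text \<open>Derivative of a homogeneous polynomial of degree \<open>k\<close> along a line. One
  argument \<open>h + s *\<^sub>R u\<close> is split by linearity and the product rule applied; the
  split-off \<open>h\<close> or \<open>u\<close> joins the prefix, so the induction keeps
  \<open>us\<close> arbitrary. For \<open>k = 0\<close> the truncated \<open>k - 1\<close> is
  harmless because of the factor 0.\<close>

lemma replicate_derivative:
  assumes "x \<in> D" "length us + k + length vs = n"
  shows "((\<lambda>s. T n x (us @ replicate k (h + s *\<^sub>R u) @ vs)) has_vector_derivative
    real k *\<^sub>R T n x (u # us @ replicate (k - 1) (h + s *\<^sub>R u) @ vs)) (at s)"
  using assms(2)
proof (induction k arbitrary: us)
  case (Suc k)
  define z where "z s = h + s *\<^sub>R u" for s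
  have "((\<lambda>s. T n x (us @ h # replicate k (z s) @ vs) + s *\<^sub>R T n x (us @ u # replicate k (z s) @ vs))
      has_vector_derivative
        real k *\<^sub>R T n x (u # us @ h # replicate (k - 1) (z s) @ vs)
        + (s *\<^sub>R (real k *\<^sub>R T n x (u # us @ u # replicate (k - 1) (z s) @ vs))
        + 1 *\<^sub>R T n x (us @ u # replicate k (z s) @ vs))) (at s)"
    using Suc.IH[of "us @ [h]"] Suc.IH[of "us @ [u]"] Suc.prems unfolding z_def
    by (intro has_vector_derivative_add has_vector_derivative_scaleR) auto
  moreover have "T n x (us @ h # replicate k (z s) @ vs) + s *\<^sub>R T n x (us @ u # replicate k (z s) @ vs)
      = T n x (us @ replicate (Suc k) (h + s *\<^sub>R u) @ vs)" for s
    using linear_slot[OF assms(1), of us "replicate k (z s) @ vs" n h s u] Suc.prems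
    by (simp add: z_def)
  moreover have "real k *\<^sub>R T n x (u # us @ h # replicate (k - 1) (z s) @ vs)
      + (s *\<^sub>R (real k *\<^sub>R T n x (u # us @ u # replicate (k - 1) (z s) @ vs))
      + 1 *\<^sub>R T n x (us @ u # replicate k (z s) @ vs))
      = real (Suc k) *\<^sub>R T n x (u # us @ replicate k (z s) @ vs)"
  proof (cases k)
    case 0
    then show ?thesis
      using move_front[OF assms(1), of us vs n u] Suc.prems by simp
  next
    case (Suc m)
    have "T n x (u # us @ replicate k (z s) @ vs) =
        T n x (u # us @ h # replicate m (z s) @ vs) + s *\<^sub>R T n x (u # us @ u # replicate m (z s) @ vs)"
      using linear_slot[OF assms(1), of "u # us" "replicate m (z s) @ vs" n h s u] Suc Suc.prems \<open>length us + Suc k + length vs = n\<close>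
      by (simp add: z_def)
    moreover have "T n x (us @ u # replicate k (z s) @ vs) = T n x (u # us @ replicate k (z s) @ vs)"
      using assms(1) \<open>length us + Suc k + length vs = n\<close> by (intro move_front) auto
    moreover have "real k *\<^sub>R a + (s *\<^sub>R (real k *\<^sub>R b) + 1 *\<^sub>R (a + s *\<^sub>R b)) = real (Suc k) *\<^sub>R (a + s *\<^sub>R b)"
      for a b :: 'b
      by (simp add: algebra_simps)
    ultimately show ?thesis
      using Suc by simp
  qed
  ultimately show ?case
    by (simp add: z_def)
qed (use assms in auto)

lemma line_derivative:
  assumes "x + s *\<^sub>R h \<in> D" "length vs = n"
  shows "((\<lambda>s. T n (x + s *\<^sub>R h) vs) has_vector_derivative T (Suc n) (x + s *\<^sub>R h) (h # vs)) (at s within S)"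
proof -
  interpret bounded_linear "\<lambda>v. T (Suc n) (x + s *\<^sub>R h) (v # vs)"
    using assms by (intro linear_first) auto
  have "((\<lambda>s. x + s *\<^sub>R h) has_derivative (\<lambda>c. c *\<^sub>R h)) (at s within S)"
    by (auto intro!: derivative_eq_intros)
  from diff_chain_within[OF this has_derivative_at_withinI[OF derivative[OF assms]]]
  show ?thesis
    by (simp add: o_def has_vector_derivative_def scaleR)
qed

end

text \<open>\<open>bound_x0\<close> is the meaning of \<gamma> with the roots removed. It includes
  \<open>n = 1\<close>, where it bounds the first derivative at \<open>x0\<close> by 1; for
  \<open>G\<close> that derivative is the identity. Order 0 is left out, as its size is governed by
  \<beta>.\<close>

locale smale_family = derivative_family T D
  for T :: "nat \<Rightarrow> 'a::banach \<Rightarrow> 'a list \<Rightarrow> 'b::banach" and D :: "'a set" +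
  fixes x0 :: 'a and \<gamma> :: real
  assumes gamma_pos: "\<gamma> > 0"
    and ball_D: "ball x0 (1 / \<gamma>) \<subseteq> D"
    and bound_x0: "n > 0 \<Longrightarrow> length vs = n \<Longrightarrow>
      norm (T n x0 vs) \<le> fact n * \<gamma> ^ (n - 1) * (\<Prod>v\<leftarrow>vs. norm v)"
begin

lemma gamma_norm_less:
  "norm h < 1 / \<gamma> \<Longrightarrow> \<gamma> * norm h < 1"
  using gamma_pos by (simp add: field_simps)

lemma in_D: "norm h < 1 / \<gamma> \<Longrightarrow> x0 + h \<in> D"
  using ball_D by (auto simp: dist_norm)

lemma x0_in_D: "x0 \<in> D"
  using in_D[of 0] gamma_pos by simp

lemma taylor_x0:
  assumes h: "norm h < 1 / \<gamma>"
  shows "(\<lambda>k. T k x0 (replicate k h) /\<^sub>R fact k) sums T 0 (x0 + h) []"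
proof -
  define q where "q = \<gamma> * norm h"
  \<comment> \<open>The series is wanted at \<open>s = 1\<close>, so \<open>R\<close> must exceed 1
    with \<open>q * R \<le> 1\<close>; for \<open>h = 0\<close> any such number will do.\<close>
  define R where "R = (if h = 0 then 2 else 1 / q)"
  define \<phi> where "\<phi> k s = T k (x0 + s *\<^sub>R h) (replicate k h)" for k s
  \<comment> \<open>The terms of positive order are bounded with \<open>1 / \<gamma>\<close>; the
    value at \<open>x0\<close> itself needs its own bound.\<close>
  define C where "C = max (norm (T 0 x0 [])) (1 / \<gamma>)"
  have q: "0 \<le> q" "q < 1"
    using gamma_pos gamma_norm_less[OF h] by (auto simp: q_def)
  have R: "R > 1" "q * R \<le> 1"
    using q gamma_pos by (auto simp: R_def q_def)
  have inD: "x0 + s *\<^sub>R h \<in> D" if "\<bar>s\<bar> < R" for s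
    using that gamma_pos by (intro in_D) (auto simp: R_def q_def field_simps split: if_splits)
  have "(\<lambda>k. (1 ^ k / fact k) *\<^sub>R \<phi> k 0) sums \<phi> 0 1"
  proof (rule taylor_sums_global[OF q(1) R(2)])
    fix n s assume s: "\<bar>s\<bar> < R"
    show "(\<phi> n has_vector_derivative \<phi> (Suc n) s) (at s)"
      unfolding \<phi>_def using line_derivative[OF inD[OF s], of "replicate n h" n] by simp
  next
    fix s assume s: "\<bar>s\<bar> < R"
    obtain r where r: "r > 0" "\<And>h'. norm h' < r \<Longrightarrow>
        (\<lambda>k. T k (x0 + s *\<^sub>R h) (replicate k h') /\<^sub>R fact k) sums T 0 (x0 + s *\<^sub>R h + h') []"
      using taylor[OF inD[OF s]] by blast
    have "(\<lambda>k. (\<sigma> ^ k / fact k) *\<^sub>R \<phi> k s) sums \<phi> 0 (s + \<sigma>)" if "\<bar>\<sigma>\<bar> < r / (norm h + 1)" for \<sigma>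
    proof -
      have "norm h + 1 > 0"
        by (smt (verit) norm_ge_zero)
      then have "\<bar>\<sigma>\<bar> * (norm h + 1) < r"
        using that by (simp add: field_simps)
      then have "norm (\<sigma> *\<^sub>R h) < r"
        by (simp add: algebra_simps)
      from r(2)[OF this] show ?thesis
        using scale_replicate[OF inD[OF s], of _ "[]" _ \<sigma> h]
        by (simp add: \<phi>_def scaleR_add_left add.assoc divide_inverse mult.commute)
    qed
    moreover have "r / (norm h + 1) > 0"
      using r(1) by (intro divide_pos_pos) (auto intro: add_nonneg_pos)
    ultimately show "\<exists>\<delta>>0. \<forall>\<sigma>. \<bar>\<sigma>\<bar> < \<delta> \<longrightarrow> (\<lambda>k. (\<sigma> ^ k / fact k) *\<^sub>R \<phi> k s) sums \<phi> 0 (s + \<sigma>)"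
      by blast
  next
    fix k
    show "norm (\<phi> k 0) \<le> C * fact k * q ^ k"
    proof (cases k)
      case 0
      then show ?thesis by (simp add: \<phi>_def C_def)
    next
      case (Suc m)
      have "norm (\<phi> k 0) \<le> fact k * \<gamma> ^ m * norm h ^ k"
        using bound_x0[of k "replicate k h"] Suc by (simp add: \<phi>_def)
      also have "\<dots> = 1 / \<gamma> * fact k * q ^ k"
        using gamma_pos by (simp add: q_def Suc power_mult_distrib field_simps)
      also have "\<dots> \<le> C * fact k * q ^ k"
        using q by (intro mult_right_mono) (auto simp: C_def)
      finally show ?thesis .
    qed
  qed (use R in auto)
  then show ?thesis
    by (simp add: \<phi>_def divide_inverse)
qed

text \<open>Stated with a radius \<open>r\<close> instead of \<open>norm h\<close> so that one
  summable bound serves all nearby \<open>h\<close> in termwise differentiation. The quotient of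
  factorials produces the binomial coefficient.\<close>

lemma term_bound:
  assumes "norm h \<le> r" "length us = j" "j > 0"
  shows "norm (T (k + j) x0 (replicate k h @ us) /\<^sub>R fact k)
    \<le> fact j * \<gamma> ^ (j - 1) * (\<Prod>v\<leftarrow>us. norm v) * (real ((k + j) choose j) * (\<gamma> * r) ^ k)"
proof -
  have P: "(\<Prod>v\<leftarrow>us. norm v) \<ge> 0"
    by (induction us) auto
  have "norm (T (k + j) x0 (replicate k h @ us) /\<^sub>R fact k)
      = norm (T (k + j) x0 (replicate k h @ us)) / fact k"
    by (simp add: divide_inverse)
  also have "\<dots> \<le> fact (k + j) * \<gamma> ^ (k + j - 1) * (norm h ^ k * (\<Prod>v\<leftarrow>us. norm v)) / fact k"
    using bound_x0[of "k + j" "replicate k h @ us"] assms by (intro divide_right_mono) auto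
  also have "\<dots> \<le> fact (k + j) * \<gamma> ^ (k + j - 1) * (r ^ k * (\<Prod>v\<leftarrow>us. norm v)) / fact k"
    using assms gamma_pos P by (intro divide_right_mono mult_left_mono mult_right_mono power_mono) auto
  also have "\<gamma> ^ (k + j - 1) = \<gamma> ^ k * \<gamma> ^ (j - 1)"
    using assms by (simp flip: power_add)
  also have "fact (k + j) * (\<gamma> ^ k * \<gamma> ^ (j - 1)) * (r ^ k * (\<Prod>v\<leftarrow>us. norm v)) / fact k
      = (fact (k + j) / fact k) * \<gamma> ^ (j - 1) * (\<Prod>v\<leftarrow>us. norm v) * (\<gamma> * r) ^ k"
    by (simp add: power_mult_distrib)
  finally show ?thesis
    unfolding fact_ratio by (simp add: mult_ac)
qed

lemma term_bound_sums:
  assumes "0 \<le> r" "r < 1 / \<gamma>"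
  shows "(\<lambda>k. c * (real ((k + j) choose j) * (\<gamma> * r) ^ k)) sums (c * (1 / (1 - \<gamma> * r) ^ Suc j))"
  using assms gamma_pos by (intro sums_mult negative_binomial_sums) (auto simp: field_simps)

text \<open>Induction on the order: moving \<open>h\<close> to \<open>h + s *\<^sub>R u\<close> and
  differentiating at \<open>s = 0\<close> gives the next derivative of \<open>T\<close> on one side
  and the termwise derivative on the other; uniqueness of derivatives equates them.\<close>

lemma taylor_derivative_x0:
  assumes "norm h < 1 / \<gamma>" "length us = j"
  shows "(\<lambda>k. T (k + j) x0 (replicate k h @ us) /\<^sub>R fact k) sums T j (x0 + h) us"
  using assms
proof (induction j arbitrary: h us)
  case 0
  then show ?case
    using taylor_x0[of h] by simp
next
  case (Suc j)
  obtain u vs where us: "us = u # vs" and vs: "length vs = j"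
    using Suc.prems by (cases us) auto
  obtain r where r: "norm h < r" "r < 1 / \<gamma>"
    using dense[OF Suc.prems(1)] by auto
  have r0: "0 \<le> r"
    using r(1) order_trans[OF norm_ge_zero less_imp_le] by blast
  have u1: "norm u + 1 > 0"
    by (intro add_nonneg_pos) auto
  define e where "e = (r - norm h) / (norm u + 1)"
  define S where "S = {-e<..<e}"
  define z where "z s = h + s *\<^sub>R u" for s
  have e: "e > 0"
    using r u1 by (simp add: e_def)
  have S: "open S" "convex S" "0 \<in> S"
    using e by (auto simp: S_def)
  have z: "norm (z s) < r" if "s \<in> S" for s
  proof -
    have "\<bar>s\<bar> * (norm u + 1) < r - norm h"
      using that u1 by (auto simp: S_def e_def field_simps abs_less_iff)
    then show ?thesis
      using norm_triangle_ineq[of h "s *\<^sub>R u"] by (simp add: z_def algebra_simps)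
  qed
  \<comment> \<open>The factor \<open>k\<close> from the polynomial derivative turns
    \<open>fact k\<close> into \<open>fact (k - 1)\<close>: term \<open>m + 1\<close> becomes term
    \<open>m\<close> of the next order.\<close>
  define f' where "f' k s = (case k of 0 \<Rightarrow> 0 | Suc m \<Rightarrow> T (m + Suc j) x0 (replicate m (z s) @ us) /\<^sub>R fact m)"
    for k s
  define b where "b m = fact (Suc j) * \<gamma> ^ (Suc j - 1) * (\<Prod>v\<leftarrow>us. norm v) * (real ((m + Suc j) choose Suc j) * (\<gamma> * r) ^ m)" for m
  have b: "summable b"
    unfolding b_def using term_bound_sums[OF r0 r(2)] by (rule sums_summable)
  have b_le: "norm (T (m + Suc j) x0 (replicate m (z s) @ us) /\<^sub>R fact m) \<le> b m" if "s \<in> S" for m s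
    unfolding b_def using Suc.prems z[OF that] by (intro term_bound) auto
  have IH: "(\<lambda>k. T (k + j) x0 (replicate k (z s) @ vs) /\<^sub>R fact k) sums T j (x0 + z s) vs" if "s \<in> S" for s
    using z[OF that] r(2) vs by (intro Suc.IH) auto
  have "((\<lambda>s. \<Sum>k. T (k + j) x0 (replicate k (z s) @ vs) /\<^sub>R fact k) has_vector_derivative (\<Sum>k. f' k 0)) (at 0)"
  proof (rule has_vector_derivative_series[OF S(1,2,3,3), where M="\<lambda>k. case k of 0 \<Rightarrow> 0 | Suc m \<Rightarrow> b m"])
    fix k s assume "s \<in> S"
    have "((\<lambda>s. T (k + j) x0 ([] @ replicate k (h + s *\<^sub>R u) @ vs)) has_vector_derivative
        real k *\<^sub>R T (k + j) x0 (u # [] @ replicate (k - 1) (h + s *\<^sub>R u) @ vs)) (at s)"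
      using vs by (intro replicate_derivative[OF x0_in_D]) auto
    from has_vector_derivative_scaleR[OF DERIV_const[of "inverse (fact k)"] this]
    have "((\<lambda>s. T (k + j) x0 (replicate k (z s) @ vs) /\<^sub>R fact k) has_vector_derivative
        (real k *\<^sub>R T (k + j) x0 (u # replicate (k - 1) (z s) @ vs)) /\<^sub>R fact k) (at s)"
      by (simp add: z_def)
    also have "(real k *\<^sub>R T (k + j) x0 (u # replicate (k - 1) (z s) @ vs)) /\<^sub>R fact k = f' k s"
    proof (cases k)
      case (Suc m)
      have "T (m + Suc j) x0 (replicate m (z s) @ u # vs) = T (m + Suc j) x0 (u # replicate m (z s) @ vs)"
        using vs by (intro move_front[OF x0_in_D]) auto
      then show ?thesis
        by (simp add: Suc f'_def us divide_simps del: of_nat_Suc)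
    qed (simp add: f'_def)
    finally show "((\<lambda>s. T (k + j) x0 (replicate k (z s) @ vs) /\<^sub>R fact k) has_vector_derivative f' k s) (at s)" .
  next
    fix k s assume "s \<in> S"
    then show "norm (f' k s) \<le> (case k of 0 \<Rightarrow> 0 | Suc m \<Rightarrow> b m)"
      using b_le by (auto simp: f'_def split: nat.split)
  next
    show "summable (\<lambda>k. case k of 0 \<Rightarrow> 0 | Suc m \<Rightarrow> b m)"
      using b by (subst summable_Suc_iff[symmetric]) auto
    show "summable (\<lambda>k. T (k + j) x0 (replicate k (z 0) @ vs) /\<^sub>R fact k)"
      using IH[OF S(3)] by (rule sums_summable)
  qed
  then have "((\<lambda>s. T j (x0 + z s) vs) has_vector_derivative (\<Sum>k. f' k 0)) (at 0)"
    by (rule has_vector_derivative_transform_within_open[OF _ S(1,3)]) (rule sums_unique[OF IH, symmetric])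
  moreover have "((\<lambda>s. T j (x0 + z s) vs) has_vector_derivative T (Suc j) (x0 + h) us) (at 0)"
    using line_derivative[of "x0 + h" 0 u vs j] in_D[OF Suc.prems(1)] vs by (simp add: us z_def add.assoc)
  ultimately have eq: "(\<Sum>k. f' k 0) = T (Suc j) (x0 + h) us"
    by (rule vector_derivative_unique_at)
  have "(\<lambda>m. f' (Suc m) 0) sums (\<Sum>m. f' (Suc m) 0)"
    using b_le[OF S(3)] by (intro summable_sums summable_comparison_test'[OF b]) (simp add: f'_def)
  with sums_unique[OF sums_Suc[OF this]] eq show ?case
    by (simp add: f'_def z_def)
qed

text \<open>Apart from the product of norms, the bound is the \<open>j\<close>-th derivative of the
  majorant at \<open>norm h\<close> if \<open>j \<ge> 2\<close>; for \<open>j = 1\<close> it is the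
  first derivative plus 2.\<close>

lemma derivative_bound:
  assumes h: "norm h < 1 / \<gamma>" and us: "length us = j" "j > 0"
  shows "norm (T j (x0 + h) us) \<le> fact j * \<gamma> ^ (j - 1) * (\<Prod>v\<leftarrow>us. norm v) / (1 - \<gamma> * norm h) ^ Suc j"
proof -
  have "norm (T j (x0 + h) us) \<le> fact j * \<gamma> ^ (j - 1) * (\<Prod>v\<leftarrow>us. norm v) * (1 / (1 - \<gamma> * norm h) ^ Suc j)"
    by (rule norm_sums_le[OF taylor_derivative_x0[OF h us(1)] term_bound_sums[OF norm_ge_zero h] term_bound[OF order_refl us]])
  then show ?thesis
    by simp
qed

text \<open>Dropping the order 0 term from both the series and its majorant keeps the
  \<open>- 1\<close>; the bound is the increase \<open>f'(norm h) - f'(0)\<close>, where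
  \<open>f'(0) = - 1\<close>.\<close>

lemma first_derivative_diff_bound:
  assumes h: "norm h < 1 / \<gamma>"
  shows "norm (T 1 (x0 + h) [v] - T 1 x0 [v]) \<le> (1 / (1 - \<gamma> * norm h)\<^sup>2 - 1) * norm v"
proof -
  note s = term_bound_sums[OF norm_ge_zero h, where c="norm v" and j=1]
  note l = taylor_derivative_x0[OF h, of "[v]" 1, simplified]
  have "(\<lambda>k. T (Suc k + 1) x0 (replicate (Suc k) h @ [v]) /\<^sub>R fact (Suc k)) sums (T 1 (x0 + h) [v] - T 1 x0 [v])"
    using sums_Suc_iff[of "\<lambda>k. T (k + 1) x0 (replicate k h @ [v]) /\<^sub>R fact k"] l by simp
  moreover have "(\<lambda>k. norm v * (real ((Suc k + 1) choose 1) * (\<gamma> * norm h) ^ Suc k)) sums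
      (norm v * (1 / (1 - \<gamma> * norm h)\<^sup>2) - norm v)"
    using sums_Suc_iff[of "\<lambda>k. norm v * (real ((k + 1) choose 1) * (\<gamma> * norm h) ^ k)"] s
    by (simp add: power2_eq_square)
  moreover have "norm (T (Suc k + 1) x0 (replicate (Suc k) h @ [v]) /\<^sub>R fact (Suc k))
      \<le> norm v * (real ((Suc k + 1) choose 1) * (\<gamma> * norm h) ^ Suc k)" for k
    using term_bound[OF order_refl, of "[v]" 1 "Suc k" h] by simp
  ultimately have "norm (T 1 (x0 + h) [v] - T 1 x0 [v]) \<le> norm v * (1 / (1 - \<gamma> * norm h)\<^sup>2) - norm v"
    by (rule norm_sums_le)
  then show ?thesis
    by (simp add: algebra_simps)
qed

text \<open>The tail from order 2 on is geometric, and its sum is the nonlinear part of the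
  majorant.\<close>

lemma linearisation_bound:
  assumes h: "norm h < 1 / \<gamma>"
  shows "norm (T 0 (x0 + h) [] - T 0 x0 [] - T 1 x0 [h]) \<le> \<gamma> * (norm h)\<^sup>2 / (1 - \<gamma> * norm h)"
proof -
  define z where "z = \<gamma> * norm h"
  have z: "0 \<le> z" "z < 1"
    using gamma_norm_less[OF h] gamma_pos by (auto simp: z_def)
  have "(\<lambda>k. T (k + 2) x0 (replicate (k + 2) h) /\<^sub>R fact (k + 2)) sums (T 0 (x0 + h) [] - T 0 x0 [] - T 1 x0 [h])"
    using sums_split_initial_segment[OF taylor_x0[OF h], of 2] by (simp add: eval_nat_numeral algebra_simps)
  moreover have "(\<lambda>k. \<gamma> * (norm h)\<^sup>2 * z ^ k) sums (\<gamma> * (norm h)\<^sup>2 * (1 / (1 - z)))"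
    using z by (intro sums_mult geometric_sums) auto
  moreover have "norm (T (k + 2) x0 (replicate (k + 2) h) /\<^sub>R fact (k + 2)) \<le> \<gamma> * (norm h)\<^sup>2 * z ^ k" for k
  proof -
    have "norm (T (k + 2) x0 (replicate (k + 2) h)) \<le> fact (k + 2) * \<gamma> ^ (k + 2 - 1) * norm h ^ (k + 2)"
      using bound_x0[of "k + 2" "replicate (k + 2) h"] by simp
    then have "norm (T (k + 2) x0 (replicate (k + 2) h)) / fact (k + 2) \<le> \<gamma> ^ (k + 2 - 1) * norm h ^ (k + 2)"
      by (simp add: field_simps del: fact_Suc)
    also have "\<dots> = \<gamma> * (norm h)\<^sup>2 * z ^ k"
      by (simp add: z_def power_mult_distrib power2_eq_square)
    finally show ?thesis
      by (simp add: divide_inverse mult.commute del: fact_Suc)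
  qed
  ultimately have "norm (T 0 (x0 + h) [] - T 0 x0 [] - T 1 x0 [h]) \<le> \<gamma> * (norm h)\<^sup>2 * (1 / (1 - z))"
    by (rule norm_sums_le)
  then show ?thesis
    by (simp add: z_def)
qed

text \<open>The point is located only by an upper bound \<tau> on its distance to \<open>x0\<close>,
  because an iterate is compared with a scalar \<open>t k\<close> and not with its actual distance.
  The bound is the third order remainder of the majorant at \<tau>.\<close>

lemma taylor_remainder_bound:
  assumes w: "norm w \<le> \<tau>" and d: "\<gamma> * (\<tau> + norm d) < 1"
  defines "s \<equiv> 1 - \<gamma> * \<tau>"
  shows "norm (T 0 (x0 + w + d) [] - T 0 (x0 + w) [] - T 1 (x0 + w) [d] - T 2 (x0 + w) [d, d] /\<^sub>R 2)
    \<le> \<gamma>\<^sup>2 * norm d ^ 3 / (s ^ 3 * (s - \<gamma> * norm d))"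
proof -
  define q where "q = \<gamma> * norm d / s"
  have s: "s > \<gamma> * norm d" "\<gamma> * norm d \<ge> 0"
    using d gamma_pos by (auto simp: s_def algebra_simps)
  have s0: "s > 0"
    using s by linarith
  have q: "0 \<le> q" "q < 1"
    using s s0 by (auto simp: q_def)
  have seg: "norm (w + t *\<^sub>R d) \<le> \<tau> + t * norm d" "norm (w + t *\<^sub>R d) < 1 / \<gamma>"
    if "t \<in> {0..1}" for t
  proof -
    show 1: "norm (w + t *\<^sub>R d) \<le> \<tau> + t * norm d"
      using that w norm_triangle_ineq[of w "t *\<^sub>R d"] by simp
    have "t * norm d \<le> 1 * norm d"
      using that by (intro mult_right_mono) auto
    with 1 have "norm (w + t *\<^sub>R d) \<le> \<tau> + norm d"
      by linarith
    then have "\<gamma> * norm (w + t *\<^sub>R d) < 1"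
      using mult_left_mono[of "norm (w + t *\<^sub>R d)" "\<tau> + norm d" \<gamma>] d gamma_pos by linarith
    then show "norm (w + t *\<^sub>R d) < 1 / \<gamma>"
      using gamma_pos by (simp add: field_simps)
  qed
  define Df where "Df n t = T n (x0 + w + t *\<^sub>R d) (replicate n d)" for n t
  \<comment> \<open>With these \<open>C\<close> and \<open>q\<close>, the comparison function
    \<open>C / (1 - q * t)\<close> is
    \<open>1 / (\<gamma> * (1 - \<gamma> * (\<tau> + t * norm d)))\<close>, the non-affine part of
    the majorant along the segment.\<close>
  have "norm (Df 0 1 - (\<Sum>n<3. Df n 0 /\<^sub>R fact n)) \<le> 1 / (\<gamma> * s) * q ^ 3 / (1 - q)"
  proof (rule taylor_majorant[OF _ q])
    fix n and t :: real assume "t \<in> {0..1}"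
    then have "x0 + w + t *\<^sub>R d \<in> D"
      using in_D[OF seg(2)] by (simp add: add.assoc)
    from line_derivative[OF this, of "replicate n d" n]
    show "(Df n has_vector_derivative Df (Suc n) t) (at t within {0..1})"
      unfolding Df_def by simp
  next
    fix t :: real assume t: "t \<in> {0..1}"
    define m where "m = 1 - q * t"
    have m: "m > 0"
      using q t mult_left_mono[of t 1 q] by (auto simp: m_def)
    have sm: "s * m = 1 - \<gamma> * (\<tau> + t * norm d)"
    proof -
      have "s * q = \<gamma> * norm d"
        using s0 by (simp add: q_def)
      then have "s * m = s - \<gamma> * norm d * t"
        by (simp add: m_def right_diff_distrib mult.assoc[symmetric])
      then show ?thesis
        by (simp add: s_def algebra_simps)
    qed
    have "norm (Df 3 t) \<le> fact 3 * \<gamma> ^ 2 * norm d ^ 3 / (1 - \<gamma> * norm (w + t *\<^sub>R d)) ^ 4"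
      using derivative_bound[OF seg(2)[OF t], of "replicate 3 d" 3]
      by (simp add: Df_def add.assoc eval_nat_numeral)
    also have "\<dots> \<le> fact 3 * \<gamma> ^ 2 * norm d ^ 3 / (s * m) ^ 4"
    proof (intro divide_left_mono power_mono mult_pos_pos zero_less_power)
      show "s * m \<le> 1 - \<gamma> * norm (w + t *\<^sub>R d)"
        unfolding sm using seg(1)[OF t] gamma_pos by simp
      then show "0 < 1 - \<gamma> * norm (w + t *\<^sub>R d)"
        using mult_pos_pos[OF s0 m] by linarith
    qed (use s0 m in auto)
    also have "\<dots> = 1 / (\<gamma> * s) * fact 3 * q ^ 3 / m ^ Suc 3"
      using s0 m gamma_pos
      by (simp add: q_def power_mult_distrib power_divide divide_simps) (simp add: power2_eq_square power3_eq_cube eval_nat_numeral)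
    finally show "norm (Df 3 t) \<le> 1 / (\<gamma> * s) * fact 3 * q ^ 3 / (1 - q * t) ^ Suc 3"
      unfolding m_def .
  qed simp
  also have "1 / (\<gamma> * s) * q ^ 3 / (1 - q) = \<gamma>\<^sup>2 * norm d ^ 3 / (s ^ 3 * (s - \<gamma> * norm d))"
  proof -
    have "1 - q = (s - \<gamma> * norm d) / s"
      using s0 by (simp add: q_def field_simps)
    then show ?thesis
      using s0 s gamma_pos by (simp add: q_def power_mult_distrib power_divide power2_eq_square power3_eq_cube mult_ac)
  qed
  finally show ?thesis
    by (simp add: Df_def eval_nat_numeral algebra_simps)
qed

end

section \<open>The majorant function\<close>

lemma reciprocal_expansion:
  fixes s v :: real
  assumes "s \<noteq> 0" "s \<noteq> v"
  shows "1 / (s - v) = 1 / s + v / s\<^sup>2 + v\<^sup>2 / s ^ 3 + v ^ 3 / (s ^ 3 * (s - v))"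
proof -
  have "(1 / s + v / s\<^sup>2 + v\<^sup>2 / s ^ 3) * (s ^ 3 * (s - v)) = s ^ 3 - v ^ 3"
    using assms by (simp add: field_simps power2_eq_square power3_eq_cube)
  then have "1 / s + v / s\<^sup>2 + v\<^sup>2 / s ^ 3 = (s ^ 3 - v ^ 3) / (s ^ 3 * (s - v))"
    using assms by (simp add: nonzero_eq_divide_eq)
  then show ?thesis
    using assms by (simp add: diff_divide_distrib)
qed

lemma majorant_has_derivative:
  assumes "\<gamma> * t < 1" "\<gamma> > 0"
  shows "(majorant \<beta> \<gamma> has_real_derivative 1 / (1 - \<gamma> * t)\<^sup>2 - 2) (at t)"
proof -
  have nz: "1 - \<gamma> * t \<noteq> 0"
    using assms by simp
  have eq: "majorant \<beta> \<gamma> = (\<lambda>t. \<beta> - t + \<gamma> * t\<^sup>2 / (1 - \<gamma> * t))"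
    by (simp add: majorant_def fun_eq_iff)
  have "(majorant \<beta> \<gamma> has_real_derivative - 1 + (2 * \<gamma> * t * (1 - \<gamma> * t) + \<gamma> * t\<^sup>2 * \<gamma>) / ((1 - \<gamma> * t) * (1 - \<gamma> * t))) (at t)"
    unfolding eq by (rule derivative_eq_intros refl nz | simp)+
  moreover have "- 1 + (2 * \<gamma> * t * (1 - \<gamma> * t) + \<gamma> * t\<^sup>2 * \<gamma>) / ((1 - \<gamma> * t) * (1 - \<gamma> * t)) = 1 / (1 - \<gamma> * t)\<^sup>2 - 2"
    using nz by (simp add: divide_simps) (simp add: algebra_simps power2_eq_square)
  ultimately show ?thesis
    by (rule DERIV_cong)
qed

lemma majorant_deriv:
  assumes "\<gamma> * t < 1" "\<gamma> > 0"
  shows "deriv (majorant \<beta> \<gamma>) t = 1 / (1 - \<gamma> * t)\<^sup>2 - 2"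
  using majorant_has_derivative[OF assms] by (rule DERIV_imp_deriv)

lemma majorant_deriv_deriv:
  assumes "\<gamma> * t < 1" "\<gamma> > 0"
  shows "deriv (deriv (majorant \<beta> \<gamma>)) t = 2 * \<gamma> / (1 - \<gamma> * t) ^ 3"
proof -
  have "((\<lambda>t. 1 / (1 - \<gamma> * t)\<^sup>2 - 2) has_real_derivative 2 * \<gamma> / (1 - \<gamma> * t) ^ 3) (at t)"
  proof -
    have nz: "(1 - \<gamma> * t)\<^sup>2 \<noteq> 0"
      using assms by simp
    have "((\<lambda>t. 1 / (1 - \<gamma> * t)\<^sup>2 - 2) has_real_derivative
        2 * (1 - \<gamma> * t) * \<gamma> / ((1 - \<gamma> * t)\<^sup>2 * (1 - \<gamma> * t)\<^sup>2)) (at t)"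
      by (rule derivative_eq_intros refl nz | simp)+
    moreover have "2 * (1 - \<gamma> * t) * \<gamma> / ((1 - \<gamma> * t)\<^sup>2 * (1 - \<gamma> * t)\<^sup>2) = 2 * \<gamma> / (1 - \<gamma> * t) ^ 3"
    proof -
      have *: "2 * s * \<gamma> / (s\<^sup>2 * s\<^sup>2) = 2 * \<gamma> / s ^ 3" if "s \<noteq> 0" for s
        using that by (simp add: power2_eq_square power3_eq_cube)
      show ?thesis
        by (rule *) (use assms in simp)
    qed
    ultimately show ?thesis
      by (rule DERIV_cong)
  qed
  moreover have "open {t. \<gamma> * t < 1}" "t \<in> {t. \<gamma> * t < 1}"
    using assms by (auto intro!: open_Collect_less continuous_intros)
  ultimately have "(deriv (majorant \<beta> \<gamma>) has_real_derivative 2 * \<gamma> / (1 - \<gamma> * t) ^ 3) (at t)"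
    by (rule has_field_derivative_transform_within_open[where f="\<lambda>t. 1 / (1 - \<gamma> * t)\<^sup>2 - 2"])
      (use assms(2) in \<open>simp add: majorant_deriv\<close>)
  then show ?thesis
    by (rule DERIV_imp_deriv)
qed

lemma majorant_expansion:
  assumes "\<gamma> > 0" "\<gamma> * t < 1" "\<gamma> * (t + u) < 1"
  defines "s \<equiv> 1 - \<gamma> * t"
  shows "majorant \<beta> \<gamma> (t + u) = majorant \<beta> \<gamma> t + (1 / s\<^sup>2 - 2) * u + \<gamma> / s ^ 3 * u\<^sup>2
    + \<gamma>\<^sup>2 * u ^ 3 / (s ^ 3 * (s - \<gamma> * u))"
proof -
  have s: "s > 0" "s - \<gamma> * u > 0"
    using assms by (auto simp: s_def algebra_simps)
  \<comment> \<open>Partial fractions leave one non-affine term, a reciprocal, which has an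
    expansion with exact remainder.\<close>
  have m: "majorant \<beta> \<gamma> y = \<beta> + (2 * (1 - \<gamma> * y) - 3 + 1 / (1 - \<gamma> * y)) / \<gamma>" if "\<gamma> * y < 1" for y
    using that assms(1) by (simp add: majorant_def divide_simps) (simp add: algebra_simps power2_eq_square)
  have "majorant \<beta> \<gamma> (t + u) = \<beta> + (2 * (s - \<gamma> * u) - 3 + 1 / (s - \<gamma> * u)) / \<gamma>"
    using m[OF assms(3)] by (simp add: s_def algebra_simps)
  also have "1 / (s - \<gamma> * u) = 1 / s + (\<gamma> * u) / s\<^sup>2 + (\<gamma> * u)\<^sup>2 / s ^ 3 + (\<gamma> * u) ^ 3 / (s ^ 3 * (s - \<gamma> * u))"
    by (rule reciprocal_expansion) (use s in auto)
  also have "\<beta> + (2 * (s - \<gamma> * u) - 3 + (1 / s + (\<gamma> * u) / s\<^sup>2 + (\<gamma> * u)\<^sup>2 / s ^ 3 + (\<gamma> * u) ^ 3 / (s ^ 3 * (s - \<gamma> * u)))) / \<gamma>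
      = (\<beta> + (2 * s - 3 + 1 / s) / \<gamma>) - 2 * u + u / s\<^sup>2 + (\<gamma> * u\<^sup>2) / s ^ 3 + (\<gamma>\<^sup>2 * u ^ 3) / (s ^ 3 * (s - \<gamma> * u))"
    using assms(1) by (simp add: add_divide_distrib diff_divide_distrib power_mult_distrib) (simp add: power2_eq_square power3_eq_cube)
  also have "\<beta> + (2 * s - 3 + 1 / s) / \<gamma> = majorant \<beta> \<gamma> t"
    using m[OF assms(2)] by (simp add: s_def)
  finally show ?thesis
    by (simp add: algebra_simps)
qed

text \<open>The zeros are the parameters instead of \<alpha>: \<open>beta\<close> and
  \<open>prod\<close> are Vieta's formulas, the former for the quadratic
  \<open>f t * (1 - \<gamma> * t)\<close> in \<open>t\<close>, the latter for the same quadratic in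
  \<open>1 - \<gamma> * t\<close>.\<close>

locale halley_majorant =
  fixes \<beta> \<gamma> ts tss :: real
  assumes gamma: "\<gamma> > 0" and ts: "0 < ts" "ts < tss" and tss: "\<gamma> * tss < 1"
    and beta: "\<beta> = 2 * \<gamma> * ts * tss"
    and prod: "(1 - \<gamma> * ts) * (1 - \<gamma> * tss) = 1 / 2"
begin

abbreviation "f \<equiv> majorant \<beta> \<gamma>"

text \<open>
  These are \<open>b t = -1 / f'(t)\<close>, \<open>c t = f''(t)\<close>, \<open>l t = L\<^sub>f(t)\<close>, the Halley increment \<open>\<Delta> t\<close>, and the
  remainder \<open>\<rho> t u = f (t + u) - f t - f'(t) u - f''(t) u\<^sup>2 / 2\<close>.
\<close>

definition b where "b t = (1 - \<gamma> * t)\<^sup>2 / (2 * (1 - \<gamma> * t)\<^sup>2 - 1)"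
definition c where "c t = 2 * \<gamma> / (1 - \<gamma> * t) ^ 3"
definition l where "l t = b t * b t * c t * f t / 2"
definition \<Delta> where "\<Delta> t = b t * f t / (1 - l t)"
definition \<rho> where "\<rho> t u = \<gamma>\<^sup>2 * u ^ 3 / ((1 - \<gamma> * t) ^ 3 * (1 - \<gamma> * t - \<gamma> * u))"

lemma gamma_ts: "\<gamma> * ts < 1"
  using ts tss gamma mult_strict_left_mono[of ts tss \<gamma>] by linarith

text \<open>This says that \<open>f'\<close> is negative at \<open>ts\<close>: of two distinct
  positive numbers with product \<open>1 / 2\<close>, the larger has square above
  \<open>1 / 2\<close>.\<close>

lemma square_gt: "2 * (1 - \<gamma> * ts)\<^sup>2 > 1"
proof -
  have "(1 - \<gamma> * ts) * (1 - \<gamma> * tss) < (1 - \<gamma> * ts) * (1 - \<gamma> * ts)"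
    using ts gamma gamma_ts by (intro mult_strict_left_mono) auto
  then show ?thesis
    unfolding prod by (simp add: power2_eq_square)
qed

lemma f_factor:
  assumes "\<gamma> * t < 1"
  shows "f t = 2 * \<gamma> * (ts - t) * (tss - t) / (1 - \<gamma> * t)"
proof -
  have "f t * (1 - \<gamma> * t) = (\<beta> - t) * (1 - \<gamma> * t) + \<gamma> * t\<^sup>2"
    using assms by (simp add: majorant_def divide_simps)
  also have "\<dots> = 2 * \<gamma> * (ts - t) * (tss - t)"
  proof -
    have "2 * (1 - \<gamma> * ts) * (1 - \<gamma> * tss) = 1"
      unfolding mult.assoc prod by simp
    then have "1 + \<gamma> * (2 * \<gamma> * ts * tss) = 2 * \<gamma> * (ts + tss)"
      by (simp add: algebra_simps)
    then have "t * (1 + \<gamma> * (2 * \<gamma> * ts * tss)) = t * (2 * \<gamma> * (ts + tss))"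
      by simp
    then show ?thesis
      unfolding beta by (simp add: algebra_simps power2_eq_square)
  qed
  finally show ?thesis
    using assms by (simp add: field_simps)
qed

context
  fixes t :: real
  assumes t: "t < ts" "0 \<le> t"
begin

lemma s_bounds: "1 - \<gamma> * ts < 1 - \<gamma> * t" "1 - \<gamma> * t \<le> 1" "1 - \<gamma> * t > 0" "\<gamma> * t < 1"
proof -
  have "\<gamma> * t < \<gamma> * ts" "\<gamma> * t \<ge> 0"
    using t gamma by auto
  then show "1 - \<gamma> * ts < 1 - \<gamma> * t" "1 - \<gamma> * t \<le> 1" "1 - \<gamma> * t > 0" "\<gamma> * t < 1"
    using gamma_ts by linarith+
qed

lemma square_gt': "2 * (1 - \<gamma> * t)\<^sup>2 - 1 > 2 * (1 - \<gamma> * ts)\<^sup>2 - 1"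
  using s_bounds gamma_ts by (auto intro!: power_strict_mono)

lemma b_ge_1: "b t \<ge> 1"
proof -
  have "(1 - \<gamma> * t)\<^sup>2 \<le> 1\<^sup>2"
    using s_bounds by (intro power_mono) auto
  then show ?thesis
    using square_gt square_gt' by (simp add: b_def divide_simps)
qed

lemma b_inverse: "1 / b t = 2 - 1 / (1 - \<gamma> * t)\<^sup>2"
  using square_gt square_gt' s_bounds by (simp add: b_def divide_simps)

lemma c_pos: "c t > 0"
  using s_bounds gamma by (simp add: c_def)

lemma f_pos: "f t > 0"
  using t ts gamma s_bounds by (auto simp: f_factor)

text \<open>All powers of \<open>1 - \<gamma> * t\<close> cancel in \<open>l\<close>, which leaves a
  polynomial identity.\<close>

lemma l_eq: "l t * (2 * (1 - \<gamma> * t)\<^sup>2 - 1)\<^sup>2 = 2 * (\<gamma> * (ts - t)) * (\<gamma> * (tss - t))"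
proof -
  define s where "s = 1 - \<gamma> * t"
  define m where "m = 2 * s\<^sup>2 - 1"
  have "s > 0" "m > 0"
    using s_bounds square_gt square_gt' by (auto simp: s_def m_def)
  then show ?thesis
    unfolding l_def b_def c_def f_factor[OF s_bounds(4)] s_def[symmetric] m_def[symmetric]
    by (simp add: divide_simps) (simp add: eval_nat_numeral)
qed

lemma l_pos: "l t > 0"
  using b_ge_1 c_pos f_pos by (simp add: l_def)

text \<open>With \<open>A * B = 1 / 2\<close> and \<open>s > A > B\<close>, both
  \<open>s * (s - A)\<close> and \<open>s * (s - B)\<close> lie below
  \<open>s\<^sup>2 - 1 / 2\<close>. Multiplying the two and using
  \<open>2 * s\<^sup>2 \<ge> 1\<close> bounds the right-hand side of \<open>l_eq\<close> by
  \<open>(2 * s\<^sup>2 - 1)\<^sup>2\<close>.\<close>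

lemma l_less_1: "l t < 1"
proof -
  define s where "s = 1 - \<gamma> * t"
  define A where "A = 1 - \<gamma> * ts"
  define B where "B = 1 - \<gamma> * tss"
  have AB: "A * B = 1 / 2" "A > B" "B > 0" "s > A"
    using prod ts gamma tss s_bounds by (auto simp: A_def B_def s_def)
  have 1: "s * (s - A) < s\<^sup>2 - 1 / 2" 
  proof -
    have "A * B < A * s"
      using AB by (intro mult_strict_left_mono) auto
    then show ?thesis
      using AB(1) by (simp add: algebra_simps power2_eq_square)
  qed
  have 2: "s * (s - B) < s\<^sup>2 - 1 / 2"
  proof -
    have "A * B < s * B"
      using AB by (intro mult_strict_right_mono) auto
    then show ?thesis
      using AB(1) by (simp add: algebra_simps power2_eq_square)
  qed
  have "(s * (s - A)) * (s * (s - B)) < (s\<^sup>2 - 1 / 2) * (s\<^sup>2 - 1 / 2)"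
  proof (rule mult_strict_mono[OF 1 2])
    have "0 \<le> s * (s - A)"
      using AB by simp
    then show "0 < s\<^sup>2 - 1 / 2"
      using 1 by linarith
    show "0 \<le> s * (s - B)"
      using AB by simp
  qed
  moreover have "(s - A) * (s - B) * 1 \<le> (s - A) * (s - B) * (2 * s\<^sup>2)"
    using AB square_gt square_gt' by (intro mult_left_mono) (auto simp: s_def)
  ultimately have "2 * (s - A) * (s - B) < (2 * s\<^sup>2 - 1)\<^sup>2"
    by (simp add: algebra_simps power2_eq_square)
  moreover have "s - A = \<gamma> * (ts - t)" "s - B = \<gamma> * (tss - t)"
    by (simp_all add: s_def A_def B_def algebra_simps)
  ultimately have "2 * (\<gamma> * (ts - t)) * (\<gamma> * (tss - t)) < (2 * s\<^sup>2 - 1)\<^sup>2"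
    by (simp only:)
  then have "l t * (2 * s\<^sup>2 - 1)\<^sup>2 < 1 * (2 * s\<^sup>2 - 1)\<^sup>2"
    unfolding s_def l_eq by simp
  then show ?thesis
    by (rule mult_right_less_imp_less) simp
qed

lemma \<Delta>_mult: "(1 - l t) * \<Delta> t = b t * f t"
  using l_less_1 by (simp add: \<Delta>_def)

lemma \<Delta>_pos: "\<Delta> t > 0"
  using b_ge_1 f_pos l_less_1 by (simp add: \<Delta>_def)

lemma f_shift:
  assumes "\<gamma> * (t + u) < 1"
  shows "f (t + u) = f t - u / b t + c t / 2 * u\<^sup>2 + \<rho> t u"
proof -
  have "- (u / b t) = (1 / (1 - \<gamma> * t)\<^sup>2 - 2) * u"
    using arg_cong[OF b_inverse, of "\<lambda>x. u * x"] by (simp add: algebra_simps)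
  then show ?thesis
    using majorant_expansion[OF gamma s_bounds(4) assms] by (simp add: c_def \<rho>_def)
qed

lemma \<rho>_root_pos: "\<rho> t (ts - t) > 0"
proof -
  have "1 - \<gamma> * t - \<gamma> * (ts - t) = 1 - \<gamma> * ts"
    by (simp add: algebra_simps)
  then show ?thesis
    using gamma gamma_ts s_bounds t by (simp add: \<rho>_def)
qed

text \<open>The expansion of \<open>f\<close> at the zero \<open>ts\<close>, solved for
  \<open>b t * f t\<close>, eliminates \<open>f t\<close> from both \<open>l t\<close> and the
  Halley equation for \<Delta>.\<close>

lemma error_eq:
  defines "\<epsilon> \<equiv> ts - t"
  shows "(1 - l t) * (\<epsilon> - \<Delta> t) =
    b t * c t / 2 * (b t * c t / 2 * \<epsilon>\<^sup>2 + b t * \<rho> t \<epsilon>) * \<epsilon> + b t * \<rho> t \<epsilon>"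
proof -
  define r where "r = \<rho> t \<epsilon>"
  have b: "b t \<noteq> 0"
    using b_ge_1 by auto
  have "f t - \<epsilon> / b t + c t / 2 * \<epsilon>\<^sup>2 + r = 0"
    using f_shift[of \<epsilon>] gamma_ts by (simp add: \<epsilon>_def r_def f_factor)
  then have "b t * (f t - \<epsilon> / b t + c t / 2 * \<epsilon>\<^sup>2 + r) = 0"
    by simp
  then have bf: "b t * f t = \<epsilon> - b t * c t / 2 * \<epsilon>\<^sup>2 - b t * r"
    using b by (simp add: algebra_simps)
  have "l t = b t * c t / 2 * (b t * f t)"
    by (simp add: l_def)
  then have l: "l t = b t * c t / 2 * (\<epsilon> - b t * c t / 2 * \<epsilon>\<^sup>2 - b t * r)"
    unfolding bf .
  have "(1 - l t) * (\<epsilon> - \<Delta> t) = \<epsilon> - l t * \<epsilon> - b t * f t"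
    using \<Delta>_mult by (simp add: algebra_simps)
  also have "\<dots> = b t * c t / 2 * (b t * c t / 2 * \<epsilon>\<^sup>2 + b t * r) * \<epsilon> + b t * r"
    unfolding bf l by (simp add: algebra_simps power2_eq_square)
  finally show ?thesis
    by (simp add: r_def)
qed

text \<open>Every term on the right of \<open>error_eq\<close> is nonnegative and the last is
  positive, so the scalar iteration never reaches \<open>ts\<close>.\<close>

lemma \<Delta>_less: "\<Delta> t < ts - t"
proof -
  have "(1 - l t) * (ts - t - \<Delta> t) > 0"
    unfolding error_eq using b_ge_1 c_pos \<rho>_root_pos t by (intro add_nonneg_pos mult_nonneg_nonneg add_nonneg_nonneg mult_pos_pos) auto
  then show ?thesis
    using l_less_1 by (simp add: zero_less_mult_iff)
qed

text \<open>By the Halley equation the linear part \<open>f t - \<Delta> t / b t\<close> equals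
  \<open>- l t * \<Delta> t / b t\<close>, which cancels the fraction \<open>1 - l t\<close> of the
  quadratic term.\<close>

lemma f_next: "f (t + \<Delta> t) = c t / 2 * l t * (\<Delta> t)\<^sup>2 + \<rho> t (\<Delta> t)"
proof -
  have "\<gamma> * (t + \<Delta> t) < \<gamma> * ts"
    using \<Delta>_less gamma by (intro mult_strict_left_mono) auto
  then have f: "f (t + \<Delta> t) = f t - \<Delta> t / b t + c t / 2 * (\<Delta> t)\<^sup>2 + \<rho> t (\<Delta> t)"
    using gamma_ts by (intro f_shift) simp
  have b: "b t \<noteq> 0"
    using b_ge_1 by auto
  have "b t * (f t - \<Delta> t / b t) = - l t * \<Delta> t"
    using \<Delta>_mult b by (simp add: algebra_simps)
  moreover have "b t * (c t / 2 * (\<Delta> t)\<^sup>2 - c t / 2 * l t * (\<Delta> t)\<^sup>2) = b t * c t / 2 * ((1 - l t) * \<Delta> t) * \<Delta> t"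
    by (simp add: algebra_simps power2_eq_square)
  moreover have "b t * c t / 2 * ((1 - l t) * \<Delta> t) * \<Delta> t = l t * \<Delta> t"
    unfolding \<Delta>_mult by (simp add: l_def)
  ultimately have "b t * ((f t - \<Delta> t / b t) + (c t / 2 * (\<Delta> t)\<^sup>2 - c t / 2 * l t * (\<Delta> t)\<^sup>2)) = 0"
    unfolding distrib_left by linarith
  then have "(f t - \<Delta> t / b t) + (c t / 2 * (\<Delta> t)\<^sup>2 - c t / 2 * l t * (\<Delta> t)\<^sup>2) = 0"
    using b by (simp only: mult_eq_0_iff simp_thms)
  then have "f t - \<Delta> t / b t + c t / 2 * (\<Delta> t)\<^sup>2 = c t / 2 * l t * (\<Delta> t)\<^sup>2"
    by linarith
  then show ?thesis
    unfolding f by simp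
qed

lemma scalar_halley_step: "t - 1 / (1 - scalar_halley_L f t) * (f t / deriv f t) = t + \<Delta> t"
proof -
  have d: "deriv f t = - (1 / b t)"
    unfolding b_inverse using majorant_deriv[OF s_bounds(4) gamma] by simp
  have "scalar_halley_L f t = l t"
    using b_ge_1 unfolding scalar_halley_L_def d majorant_deriv_deriv[OF s_bounds(4) gamma]
    by (simp add: l_def c_def power2_eq_square)
  then show ?thesis
    by (simp add: d \<Delta>_def)
qed

text \<open>In \<open>error_eq\<close> the numerators combine to
  \<open>s + s * m = 2 * s ^ 3\<close>, so the scalar error is known exactly; what remains is a
  lower bound for \<open>(1 - l t) * m\<^sup>2\<close>.\<close>

lemma cubic_error:
  "ts - (t + \<Delta> t) \<le> 8 * \<gamma>\<^sup>2 / (3 * (2 * (1 - \<gamma> * ts)\<^sup>2 - 1)\<^sup>2) * (ts - t) ^ 3"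
proof -
  define s where "s = 1 - \<gamma> * t"
  define A where "A = 1 - \<gamma> * ts"
  define m where "m = 2 * s\<^sup>2 - 1"
  define d where "d = 2 * A\<^sup>2 - 1"
  define \<epsilon> where "\<epsilon> = ts - t"
  define e where "e = \<gamma> * \<epsilon>"
  have sA: "s = A + e" "0 < A" "e > 0" "s > 0" "A < 1" "m > d" "d > 0"
    using gamma_ts s_bounds t gamma square_gt square_gt' ts
    by (auto simp: s_def A_def e_def m_def d_def \<epsilon>_def algebra_simps)
  have m0: "m > 0"
    using sA by linarith
  have b: "b t = s\<^sup>2 / m" and c: "c t = 2 * \<gamma> / s ^ 3"
    by (simp_all add: b_def c_def s_def m_def)
  have \<rho>: "\<rho> t \<epsilon> = \<gamma>\<^sup>2 * \<epsilon> ^ 3 / (s ^ 3 * A)"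
    by (simp add: \<rho>_def s_def A_def \<epsilon>_def algebra_simps)
  have bc: "b t * c t / 2 = \<gamma> / (s * m)" and b\<rho>: "b t * \<rho> t \<epsilon> = \<gamma>\<^sup>2 * \<epsilon> ^ 3 / (s * m * A)"
    using sA m0 by (simp_all add: b c \<rho> power2_eq_square power3_eq_cube mult_ac)
  have "(1 - l t) * (\<epsilon> - \<Delta> t) =
      \<gamma> / (s * m) * (\<gamma> / (s * m) * \<epsilon>\<^sup>2 + \<gamma>\<^sup>2 * \<epsilon> ^ 3 / (s * m * A)) * \<epsilon> + \<gamma>\<^sup>2 * \<epsilon> ^ 3 / (s * m * A)"
    using error_eq unfolding \<epsilon>_def[symmetric] bc b\<rho> .
  also have "\<dots> = \<gamma>\<^sup>2 * \<epsilon> ^ 3 / (s\<^sup>2 * m\<^sup>2 * A) * (A + e + s * m)"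
    using sA m0 unfolding e_def by (simp add: divide_simps) (simp add: algebra_simps power2_eq_square power3_eq_cube)
  also have "A + e + s * m = 2 * s ^ 3"
    unfolding sA(1)[symmetric] m_def by (simp add: algebra_simps power2_eq_square power3_eq_cube)
  finally have "(1 - l t) * (\<epsilon> - \<Delta> t) = 2 * s * \<gamma>\<^sup>2 * \<epsilon> ^ 3 / (m\<^sup>2 * A)"
    using sA(2,4) m0 by (simp add: power2_eq_square power3_eq_cube mult_ac)
  then have "m\<^sup>2 * ((1 - l t) * (\<epsilon> - \<Delta> t)) = m\<^sup>2 * (2 * s * \<gamma>\<^sup>2 * \<epsilon> ^ 3 / (m\<^sup>2 * A))"
    by simp
  then have "(1 - l t) * m\<^sup>2 * (\<epsilon> - \<Delta> t) = 2 * s * \<gamma>\<^sup>2 * \<epsilon> ^ 3 / A"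
    using m0 by (simp add: mult_ac)
  moreover have "(1 - l t) * m\<^sup>2 = m\<^sup>2 - 2 * e * (s - 1 / (2 * A))"
  proof -
    \<comment> \<open>The product of the zeros in the variable \<open>s\<close> eliminates
      \<open>tss\<close>, leaving only \<open>A\<close> and \<open>e\<close>.\<close>
    have "1 / (2 * A) = 1 - \<gamma> * tss"
      using prod sA by (simp add: A_def field_simps)
    then have "s - 1 / (2 * A) = \<gamma> * (tss - t)"
      by (simp add: s_def algebra_simps)
    moreover have "l t * m\<^sup>2 = 2 * e * (\<gamma> * (tss - t))"
      using l_eq by (simp only: s_def m_def e_def \<epsilon>_def)
    ultimately show ?thesis
      by (simp only: left_diff_distrib mult_1)
  qed
  ultimately have eq: "(m\<^sup>2 - 2 * e * (s - 1 / (2 * A))) * (\<epsilon> - \<Delta> t) = 2 * s * \<gamma>\<^sup>2 * \<epsilon> ^ 3 / A"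
    by simp
  \<comment> \<open>The error is \<open>2 * s * \<gamma>\<^sup>2 * \<epsilon> ^ 3 / K\<close>, so
    the constant \<open>8 / 3\<close> amounts to
    \<open>3 * s * d\<^sup>2 \<le> 4 * K\<close>.\<close>
  define K where "K = A * (m\<^sup>2 - 2 * e * (s - 1 / (2 * A)))"
  have K: "K = A * m\<^sup>2 - e * (2 * A * s - 1)"
    using sA by (simp add: K_def algebra_simps)
  have "K * (\<epsilon> - \<Delta> t) = A * (2 * s * \<gamma>\<^sup>2 * \<epsilon> ^ 3 / A)"
    unfolding K_def eq[symmetric] by simp
  then have K': "K * (\<epsilon> - \<Delta> t) = 2 * s * \<gamma>\<^sup>2 * \<epsilon> ^ 3"
    using sA by simp
  \<comment> \<open>in powers of \<open>e = s - A\<close>, all coefficients of \<open>4 * K - 3 * s * d\<^sup>2\<close> are nonnegative\<close>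
  have key: "3 * s * d\<^sup>2 \<le> 4 * K"
  proof -
    have m: "m = d + 4 * A * e + 2 * e\<^sup>2"
      unfolding m_def d_def sA(1) by (simp add: algebra_simps power2_eq_square)
    have "4 * K - 3 * s * d\<^sup>2 = A * d\<^sup>2 + e * (32 * A\<^sup>2 * d - 4 * d - 3 * d\<^sup>2)
        + e\<^sup>2 * (64 * A ^ 3 + 16 * A * d - 8 * A) + 4 * A * (16 * A * e ^ 3 + 4 * e ^ 4)"
      unfolding K m sA(1) d_def by (simp add: algebra_simps eval_nat_numeral)
    moreover have "32 * A\<^sup>2 * d - 4 * d - 3 * d\<^sup>2 \<ge> 0"
    proof -
      have "32 * A\<^sup>2 * d - 4 * d - 3 * d\<^sup>2 = d * (13 * d + 12)"
        unfolding d_def by (simp add: algebra_simps power2_eq_square)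
      then show ?thesis
        using sA by simp
    qed
    moreover have "64 * A ^ 3 + 16 * A * d - 8 * A \<ge> 0"
    proof -
      have "64 * A ^ 3 + 16 * A * d - 8 * A = A * (48 * d + 24)"
        unfolding d_def by (simp add: algebra_simps power2_eq_square power3_eq_cube)
      then show ?thesis
        using sA by simp
    qed
    ultimately have "4 * K - 3 * s * d\<^sup>2 \<ge> 0"
      using sA by simp
    then show ?thesis by simp
  qed
  have "\<epsilon> - \<Delta> t \<ge> 0"
    using \<Delta>_less by (simp add: \<epsilon>_def)
  then have "3 * s * d\<^sup>2 * (\<epsilon> - \<Delta> t) \<le> 4 * K * (\<epsilon> - \<Delta> t)"
    using key by (rule mult_right_mono[rotated])
  also have "\<dots> = 8 * s * \<gamma>\<^sup>2 * \<epsilon> ^ 3"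
    using K' by simp
  finally have "s * (3 * d\<^sup>2 * (\<epsilon> - \<Delta> t)) \<le> s * (8 * \<gamma>\<^sup>2 * \<epsilon> ^ 3)"
    by (simp add: mult_ac)
  then have "3 * d\<^sup>2 * (\<epsilon> - \<Delta> t) \<le> 8 * \<gamma>\<^sup>2 * \<epsilon> ^ 3"
    using sA by simp
  then have "\<epsilon> - \<Delta> t \<le> 8 * \<gamma>\<^sup>2 / (3 * d\<^sup>2) * \<epsilon> ^ 3"
    using sA by (simp add: field_simps)
  then show ?thesis
    by (simp add: \<epsilon>_def d_def A_def algebra_simps)
qed

end

end

lemma halley_majorant_roots:
  assumes gamma: "\<gamma> > 0" and beta: "\<beta> > 0" and \<alpha>: "\<alpha> = \<beta> * \<gamma>" "\<alpha> < 3 - 2 * sqrt 2"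
    and ts: "ts = (1 + \<alpha> - sqrt ((1 + \<alpha>)\<^sup>2 - 8 * \<alpha>)) / (4 * \<gamma>)"
    and tss: "tss = (1 + \<alpha> + sqrt ((1 + \<alpha>)\<^sup>2 - 8 * \<alpha>)) / (4 * \<gamma>)"
  shows "halley_majorant \<beta> \<gamma> ts tss"
proof
  define r where "r = sqrt ((1 + \<alpha>)\<^sup>2 - 8 * \<alpha>)"
  have a: "\<alpha> > 0" "\<alpha> < 3"
    using \<alpha> gamma beta by (auto intro: less_trans)
  \<comment> \<open>The discriminant equals \<open>(3 - \<alpha>)\<^sup>2 - 8\<close>. This also
    gives \<open>r < 3 - \<alpha>\<close> below, which is \<open>\<gamma> * tss < 1\<close>.\<close>
  have "(2 * sqrt 2)\<^sup>2 < (3 - \<alpha>)\<^sup>2"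
    using \<alpha> by (intro power_strict_mono) auto
  then have disc: "(1 + \<alpha>)\<^sup>2 - 8 * \<alpha> > 0"
    by (simp add: power2_eq_square algebra_simps)
  then have r: "r > 0" "r\<^sup>2 = (1 + \<alpha>)\<^sup>2 - 8 * \<alpha>"
    by (auto simp: r_def)
  have "r\<^sup>2 < (1 + \<alpha>)\<^sup>2" "r\<^sup>2 < (3 - \<alpha>)\<^sup>2"
    unfolding r(2) using a by (auto simp: power2_eq_square algebra_simps)
  then have r': "r < 1 + \<alpha>" "r < 3 - \<alpha>"
    using a by (auto intro: power2_less_imp_less)
  have g: "\<gamma> * ts = (1 + \<alpha> - r) / 4" "\<gamma> * tss = (1 + \<alpha> + r) / 4"
    using gamma by (auto simp: ts tss r_def field_simps)
  show "\<gamma> > 0" by fact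
  show "0 < ts" "ts < tss"
    using r r' gamma unfolding ts tss r_def[symmetric] by (auto simp: divide_strict_right_mono)
  show "\<gamma> * tss < 1"
    using g r' by simp
  have p: "16 * ((\<gamma> * ts) * (\<gamma> * tss)) = 8 * \<alpha>"
    unfolding g using r(2) by (simp add: power2_eq_square algebra_simps)
  have "(1 - \<gamma> * ts) * (1 - \<gamma> * tss) = 1 - \<gamma> * ts - \<gamma> * tss + (\<gamma> * ts) * (\<gamma> * tss)"
    by (simp add: algebra_simps)
  also have "(\<gamma> * ts) * (\<gamma> * tss) = \<alpha> / 2"
    using p by (simp add: mult_ac)
  also have "1 - \<gamma> * ts - \<gamma> * tss + \<alpha> / 2 = 1 / 2"
    unfolding g by (simp add: field_simps)
  finally show "(1 - \<gamma> * ts) * (1 - \<gamma> * tss) = 1 / 2" .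
  have "\<gamma> * (2 * \<gamma> * ts * tss) = \<gamma> * \<beta>"
    using p \<alpha> by (simp add: algebra_simps)
  then show "\<beta> = 2 * \<gamma> * ts * tss"
    using gamma by simp
qed

section \<open>One step of Halley's method\<close>

lemma nonsingularI:
  fixes A :: "'a::banach \<Rightarrow> 'b::banach"
  assumes A: "bounded_linear A" and bij: "bij A"
    and bound: "\<And>w. norm (inv A w) \<le> C * norm w"
  shows "nonsingular A"
proof -
  interpret A: bounded_linear A by fact
  have "linear (inv A)"
  proof (rule linearI)
    show "inv A (u + v) = inv A u + inv A v" for u v
      by (rule inv_f_eq[OF bij_is_inj[OF bij]]) (simp add: A.add surj_f_inv_f[OF bij_is_surj[OF bij]])
    show "inv A (r *\<^sub>R u) = r *\<^sub>R inv A u" for r u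
      by (rule inv_f_eq[OF bij_is_inj[OF bij]]) (simp add: A.scaleR surj_f_inv_f[OF bij_is_surj[OF bij]])
  qed
  then have "bounded_linear (inv A)"
    using bound by (intro bounded_linear.intro bounded_linear_axioms.intro) (auto simp: mult.commute)
  with A bij show ?thesis
    by (simp add: nonsingular_def)
qed

text \<open>Solving \<open>v - Q v = w\<close> means finding the fixed point of the contraction
  sending \<open>v\<close> to \<open>w + Q v\<close>. It serves both for the first derivative of
  \<open>G\<close> and for \<open>I - L\<close>.\<close>

lemma nonsingular_id_minus:
  fixes Q :: "'a::banach \<Rightarrow> 'a"
  assumes Q: "bounded_linear Q" "\<And>v. norm (Q v) \<le> q * norm v" and q: "0 \<le> q" "q < 1"
  shows "nonsingular (\<lambda>v. v - Q v)" "norm (inv (\<lambda>v. v - Q v) w) \<le> 1 / (1 - q) * norm w"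
proof -
  interpret Q: bounded_linear Q by fact
  define A where "A v = v - Q v" for v
  have A: "bounded_linear A"
    unfolding A_def by (intro bounded_linear_sub bounded_linear_ident Q)
  have ex1: "\<exists>!v. w + Q v = v" for w
    using Q(2) by (intro banach_fix_type[OF q]) (auto simp: dist_norm simp flip: Q.diff)
  have eq: "w + Q v = v \<longleftrightarrow> A v = w" for v w
    by (auto simp: A_def algebra_simps)
  have bij: "bij A"
    unfolding bij_iff using ex1 unfolding eq by blast
  have lower: "norm (inv A w) \<le> 1 / (1 - q) * norm w" for w
  proof -
    define v where "v = inv A w"
    have "v = w + Q v"
      using surj_f_inv_f[OF bij_is_surj[OF bij], of w] by (simp add: v_def A_def algebra_simps)
    then have "norm v \<le> norm w + q * norm v"
      using norm_triangle_ineq[of w "Q v"] Q(2)[of v] by simp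
    then show ?thesis
      unfolding v_def using q by (simp add: field_simps)
  qed
  show "nonsingular (\<lambda>v. v - Q v)" "norm (inv (\<lambda>v. v - Q v) w) \<le> 1 / (1 - q) * norm w"
    using nonsingularI[OF A bij lower] lower unfolding A_def by auto
qed

text \<open>Source and target spaces coincide because \<open>T\<close> stands for the derivatives of
  \<open>G\<close>; this is what allows a comparison with the identity.\<close>

locale halley_family = smale_family T D x0 \<gamma> + halley_majorant \<beta> \<gamma> ts tss
  for T :: "nat \<Rightarrow> 'a::banach \<Rightarrow> 'a list \<Rightarrow> 'a" and D :: "'a set" and x0 :: 'a and \<beta> \<gamma> ts tss :: real +
  assumes T1_x0: "T 1 x0 [v] = v"
    and T0_x0: "norm (T 0 x0 []) \<le> \<beta>"
begin

definition P where "P x = inv (\<lambda>v. T 1 x [v])"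
definition L where "L x v = (1 / 2) *\<^sub>R P x (T 2 x [P x (T 0 x []), v])"
definition step where "step x = x - inv (\<lambda>v. v - L x v) (P x (T 0 x []))"

lemma less_radius: "y < tss \<Longrightarrow> y < 1 / \<gamma>"
proof -
  assume "y < tss"
  then have "\<gamma> * y < \<gamma> * tss"
    using gamma by simp
  then have "\<gamma> * y < 1"
    using tss by linarith
  then show ?thesis
    using gamma by (simp add: field_simps)
qed

lemma first_derivative_near_id:
  assumes "norm (x - x0) \<le> t" "t < tss"
  shows "norm (v - T 1 x [v]) \<le> (1 / (1 - \<gamma> * t)\<^sup>2 - 1) * norm v"
proof -
  have n: "norm (x - x0) < 1 / \<gamma>"
    using assms less_radius by simp
  have "norm (v - T 1 x [v]) \<le> (1 / (1 - \<gamma> * norm (x - x0))\<^sup>2 - 1) * norm v"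
    using first_derivative_diff_bound[OF n, of v] by (simp add: T1_x0 norm_minus_commute del: One_nat_def)
  also have "\<dots> \<le> (1 / (1 - \<gamma> * t)\<^sup>2 - 1) * norm v"
  proof (intro mult_right_mono diff_right_mono divide_left_mono power_mono mult_pos_pos zero_less_power)
    show t: "0 < 1 - \<gamma> * t"
      using less_radius[OF assms(2)] gamma by (simp add: field_simps)
    show "1 - \<gamma> * t \<le> 1 - \<gamma> * norm (x - x0)"
      using assms(1) gamma by simp
    then show "0 < 1 - \<gamma> * norm (x - x0)"
      using t by linarith
  qed (use less_radius[OF assms(2)] gamma in \<open>auto simp: field_simps\<close>)
  finally show ?thesis .
qed

context
  fixes x :: 'a and t :: real
  assumes x: "norm (x - x0) \<le> t" and t: "t < ts" "0 \<le> t"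
begin

lemma x_D: "x \<in> D" and x_radius: "norm (x - x0) < 1 / \<gamma>"
  using in_D[of "x - x0"] x t ts less_radius[of "norm (x - x0)"] by auto

lemmas s = s_bounds[OF t]

lemma linear_T1: "bounded_linear (\<lambda>v. T 1 x [v])"
  by (rule linear_first[OF x_D]) auto

lemma linear_T2: "bounded_linear (\<lambda>u. T 2 x [u, v])" "bounded_linear (\<lambda>u. T 2 x [v, u])"
proof -
  show 1: "bounded_linear (\<lambda>u. T 2 x [u, v])"
    by (rule linear_first[OF x_D]) auto
  have "T 2 x [v, u] = T 2 x [u, v]" for u
    using swap[OF x_D, of "[]" "[]" 2 v u] by simp
  with 1 show "bounded_linear (\<lambda>u. T 2 x [v, u])"
    by simp
qed

lemma T2_bound: "norm (T 2 x [u, v]) \<le> c t * norm u * norm v"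
proof -
  have "norm (T 2 x [u, v]) \<le> 2 * \<gamma> * norm u * norm v / (1 - \<gamma> * norm (x - x0)) ^ 3"
    using derivative_bound[OF x_radius, of "[u, v]" 2] by (simp add: eval_nat_numeral mult.assoc)
  also have "\<dots> \<le> 2 * \<gamma> * norm u * norm v / (1 - \<gamma> * t) ^ 3"
  proof (intro divide_left_mono power_mono mult_pos_pos zero_less_power)
    show *: "1 - \<gamma> * t \<le> 1 - \<gamma> * norm (x - x0)"
      using x gamma by simp
    show "0 < 1 - \<gamma> * norm (x - x0)"
      using * s(3) by linarith
  qed (use s gamma in auto)
  finally show ?thesis
    by (simp add: c_def)
qed

text \<open>The first derivative differs from the identity by at most \<open>q\<close>, where
  \<open>1 - q\<close> is \<open>- f'(t)\<close>; hence the inverse is bounded by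
  \<open>b t\<close>.\<close>

lemma nonsingular_T1: "nonsingular (\<lambda>v. T 1 x [v])"
  and P_bound: "norm (P x w) \<le> b t * norm w"
proof -
  define q where "q = 1 / (1 - \<gamma> * t)\<^sup>2 - 1"
  have bq: "1 - q = 1 / b t"
    using b_inverse[OF t] by (simp add: q_def)
  then have qb: "1 / (1 - q) = b t"
    by simp
  have "0 < 1 / b t" "1 / b t \<le> 1"
    using b_ge_1[OF t] by auto
  then have q: "0 \<le> q" "q < 1"
    unfolding bq[symmetric] by auto
  have lin: "bounded_linear (\<lambda>v. v - T 1 x [v])"
    by (intro bounded_linear_sub bounded_linear_ident linear_T1)
  have "norm (v - T 1 x [v]) \<le> q * norm v" for v
    unfolding q_def using t ts by (intro first_derivative_near_id[OF x]) auto
  from nonsingular_id_minus[OF lin this q]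
  show "nonsingular (\<lambda>v. T 1 x [v])" "norm (P x w) \<le> b t * norm w"
    unfolding qb P_def by auto
qed

lemma linear_P: "bounded_linear (P x)"
  using nonsingular_T1 by (simp add: nonsingular_def P_def)

lemma T1_P: "T 1 x [P x w] = w"
  using nonsingular_T1 surj_f_inv_f[of "\<lambda>v. T 1 x [v]" w] by (simp add: nonsingular_def P_def bij_is_surj)

lemma P_T1: "P x (T 1 x [v]) = v"
  using nonsingular_T1 inv_f_f[of "\<lambda>v. T 1 x [v]" v] by (simp add: nonsingular_def P_def bij_is_inj)

lemma remainder_bound:
  assumes "\<gamma> * (t + norm d) < 1"
  shows "norm (T 0 (x + d) [] - T 0 x [] - T 1 x [d] - (1 / 2) *\<^sub>R T 2 x [d, d]) \<le> \<rho> t (norm d)"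
  using taylor_remainder_bound[OF x assms] by (simp add: \<rho>_def)

context
  assumes G: "norm (T 0 x []) \<le> f t"
begin

lemma linear_L: "bounded_linear (L x)"
  unfolding L_def
  by (intro bounded_linear_const_scaleR bounded_linear_compose[OF linear_P] linear_T2)

lemma L_bound: "norm (L x v) \<le> l t * norm v"
proof -
  have "norm (L x v) \<le> b t * norm (T 2 x [P x (T 0 x []), v]) / 2"
    using P_bound[of "T 2 x [P x (T 0 x []), v]"] by (simp add: L_def)
  also have "\<dots> \<le> b t * (c t * norm (P x (T 0 x [])) * norm v) / 2"
    using b_ge_1[OF t] by (intro divide_right_mono mult_left_mono T2_bound) auto
  also have "\<dots> \<le> b t * (c t * (b t * f t) * norm v) / 2"
    using b_ge_1[OF t] c_pos[OF t] order_trans[OF P_bound mult_left_mono[OF G, of "b t"]]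
    by (intro divide_right_mono mult_left_mono mult_right_mono) auto
  finally show ?thesis
    by (simp add: l_def mult_ac)
qed

lemma nonsingular_L: "nonsingular (\<lambda>v. v - L x v)"
  using nonsingular_id_minus(1)[OF linear_L L_bound] l_pos[OF t] l_less_1[OF t] by simp

lemma step_bound: "norm (step x - x) \<le> \<Delta> t"
proof -
  have "norm (step x - x) \<le> 1 / (1 - l t) * norm (P x (T 0 x []))"
    using nonsingular_id_minus(2)[OF linear_L L_bound, of "P x (T 0 x [])"] l_pos[OF t] l_less_1[OF t]
    by (simp add: step_def)
  also have "\<dots> \<le> 1 / (1 - l t) * (b t * f t)"
    using l_less_1[OF t] b_ge_1[OF t]
    by (intro mult_left_mono order_trans[OF P_bound] mult_left_mono G) auto
  finally show ?thesis
    by (simp add: \<Delta>_def)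
qed

lemma step_eq: "(step x - x) - L x (step x - x) = - P x (T 0 x [])"
proof -
  interpret L: bounded_linear "L x" by (rule linear_L)
  define w where "w = inv (\<lambda>v. v - L x v) (P x (T 0 x []))"
  have "w - L x w = P x (T 0 x [])"
    using surj_f_inv_f[of "\<lambda>v. v - L x v"] nonsingular_L
    by (simp add: w_def nonsingular_def bij_is_surj)
  moreover have "step x - x = - w"
    by (simp add: step_def w_def)
  ultimately show ?thesis
    by (simp add: L.neg flip: \<open>w - L x w = P x (T 0 x [])\<close>)
qed

lemma value_step: "norm (T 0 (step x) []) \<le> f (t + \<Delta> t)"
proof -
  interpret T1: bounded_linear "\<lambda>v. T 1 x [v]" by (rule linear_T1)
  define d where "d = step x - x"
  define n where "n = P x (T 0 x [])"
  interpret T2: bounded_linear "\<lambda>v. T 2 x [v, d]" by (rule linear_T2)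
  have "\<gamma> * (t + norm d) \<le> \<gamma> * ts"
    using step_bound \<Delta>_less[OF t] gamma by (intro mult_left_mono) (auto simp: d_def)
  then have small: "\<gamma> * (t + norm d) < 1"
    using gamma_ts by simp
  have nd: "n + d = L x d"
    using step_eq unfolding d_def[symmetric] n_def[symmetric] by (simp add: algebra_simps)
  \<comment> \<open>The left side is \<open>G'(x)(n + d)\<close>, and \<open>n + d = L x d\<close>
    by the Halley equation, so it is half of \<open>G''(x)(n, d)\<close>. Together with the
    quadratic term, \<open>n + d\<close> reappears in the first slot.\<close>
  have "T 0 x [] + T 1 x [d] = T 1 x [n + d]"
    by (simp add: T1.add n_def T1_P del: One_nat_def)
  also have "\<dots> = (1 / 2) *\<^sub>R T 2 x [n, d]"
    unfolding nd by (simp add: L_def T1.scaleR n_def T1_P del: One_nat_def)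
  finally have "T 0 x [] + T 1 x [d] + (1 / 2) *\<^sub>R T 2 x [d, d] = (1 / 2) *\<^sub>R T 2 x [n + d, d]"
    by (simp add: T2.add scaleR_add_right)
  also have "n + d = L x d"
    by (rule nd)
  finally have eq: "T 0 (step x) [] = (1 / 2) *\<^sub>R T 2 x [L x d, d]
      + (T 0 (x + d) [] - T 0 x [] - T 1 x [d] - (1 / 2) *\<^sub>R T 2 x [d, d])"
    by (simp add: d_def algebra_simps)
  have "norm (T 2 x [L x d, d]) \<le> c t * (l t * \<Delta> t) * \<Delta> t"
    using step_bound c_pos[OF t] l_pos[OF t] \<Delta>_pos[OF t] unfolding d_def[symmetric]
    by (intro order_trans[OF T2_bound] mult_mono order_trans[OF L_bound]) auto
  \<comment> \<open>\<open>\<rho> t\<close> is increasing as long as its denominator stays positive,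
    which \<open>t + \<Delta> t < ts\<close> guarantees.\<close>
  moreover have "\<rho> t (norm d) \<le> \<rho> t (\<Delta> t)"
  proof -
    have "\<gamma> * norm d \<le> \<gamma> * \<Delta> t" "\<gamma> * \<Delta> t < \<gamma> * (ts - t)"
      using step_bound \<Delta>_less[OF t] gamma by (auto simp: d_def)
    then have "1 - \<gamma> * t - \<gamma> * \<Delta> t > 0" "1 - \<gamma> * t - \<gamma> * \<Delta> t \<le> 1 - \<gamma> * t - \<gamma> * norm d"
      using gamma_ts by (auto simp: algebra_simps)
    then show ?thesis
      unfolding \<rho>_def using s(3) step_bound \<Delta>_pos[OF t]
      by (intro frac_le mult_left_mono power_mono mult_nonneg_nonneg mult_pos_pos) (auto simp: d_def)
  qed
  ultimately have "norm (T 0 (step x) []) \<le> c t * (l t * \<Delta> t) * \<Delta> t / 2 + \<rho> t (\<Delta> t)"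
    unfolding eq using remainder_bound[OF small]
    by (intro order_trans[OF norm_triangle_ineq] add_mono) auto
  then show ?thesis
    unfolding f_next[OF t] by (simp add: power2_eq_square mult_ac)
qed

text \<open>All terms of the error bound have order at least 3 in \<open>norm e\<close>. Shrinking
  \<open>norm e\<close> from \<epsilon> by a factor at most 1 therefore shrinks the bound by at
  least the cube of that factor, and at \<epsilon> the bound is the exact scalar error of
  \<open>error_eq\<close>.\<close>

lemma error_step:
  assumes y: "T 0 y [] = 0" "norm (y - x) \<le> ts - t"
  shows "norm (y - step x) \<le> (ts - (t + \<Delta> t)) * (norm (y - x) / (ts - t)) ^ 3"
proof -
  interpret P: bounded_linear "P x" by (rule linear_P)
  interpret L: bounded_linear "L x" by (rule linear_L)
  define e where "e = y - x"
  define n where "n = P x (T 0 x [])"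
  interpret T2: bounded_linear "\<lambda>v. T 2 x [v, e]" by (rule linear_T2)
  define \<epsilon> where "\<epsilon> = ts - t"
  define R where "R = T 0 (x + e) [] - T 0 x [] - T 1 x [e] - (1 / 2) *\<^sub>R T 2 x [e, e]"
  define W where "W = P x ((1 / 2) *\<^sub>R T 2 x [e, e] + R)"
  define z where "z = y - step x"
  define r where "r = \<rho> t (norm e)"
  have \<epsilon>: "\<epsilon> > 0" "norm e \<le> \<epsilon>"
    using t y by (auto simp: \<epsilon>_def e_def)
  have g\<epsilon>: "\<gamma> * norm e \<le> \<gamma> * ts - \<gamma> * t"
    using \<epsilon> gamma mult_left_mono[of "norm e" \<epsilon> \<gamma>] by (auto simp: \<epsilon>_def algebra_simps)
  have "\<gamma> * (t + norm e) < 1"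
    using g\<epsilon> gamma_ts by (simp add: algebra_simps)
  then have R: "norm R \<le> r"
    unfolding R_def r_def by (rule remainder_bound)
  have "R = - T 0 x [] - T 1 x [e] - (1 / 2) *\<^sub>R T 2 x [e, e]"
    using y by (simp add: R_def e_def)
  then have W: "W = - n - e"
    by (simp add: W_def n_def P.diff P.neg P_T1 del: One_nat_def)
  have zL: "z - L x z = e + n - L x e"
    using step_eq by (simp add: z_def e_def n_def L.diff algebra_simps)
  also have "L x e = (1 / 2) *\<^sub>R P x (T 2 x [n, e])"
    by (simp add: L_def n_def)
  also have "n = - e - W"
    using W by simp
  also have "e + (- e - W) - (1 / 2) *\<^sub>R P x (T 2 x [- e - W, e]) = (1 / 2) *\<^sub>R P x (T 2 x [W, e]) - P x R"
    by (simp add: T2.diff T2.neg P.diff P.neg W_def P.add P.scaleR algebra_simps)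
  finally have zeq: "z - L x z = (1 / 2) *\<^sub>R P x (T 2 x [W, e]) - P x R" .
  have b: "b t \<ge> 0" and c: "c t \<ge> 0"
    using b_ge_1[OF t] c_pos[OF t] by auto
  have Wn: "norm W \<le> b t * (c t / 2 * (norm e)\<^sup>2 + r)"
    unfolding W_def using R T2_bound[of e e] b
    by (intro order_trans[OF P_bound] mult_left_mono order_trans[OF norm_triangle_ineq] add_mono)
      (auto simp: power2_eq_square)
  have PRn: "norm (P x R) \<le> b t * r"
    using R b by (intro order_trans[OF P_bound] mult_left_mono)
  have "norm (P x (T 2 x [W, e])) \<le> b t * (c t * (b t * (c t / 2 * (norm e)\<^sup>2 + r)) * norm e)"
    using Wn b c by (intro order_trans[OF P_bound] mult_left_mono order_trans[OF T2_bound] mult_right_mono) auto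
  then have "norm (z - L x z) \<le> b t * (c t * (b t * (c t / 2 * (norm e)\<^sup>2 + r)) * norm e) / 2 + b t * r"
    unfolding zeq using PRn by (intro order_trans[OF norm_triangle_ineq4] add_mono) auto
  moreover have "(1 - l t) * norm z \<le> norm (z - L x z)"
    using norm_triangle_ineq2[of z "L x z"] L_bound[of z] by (simp add: algebra_simps)
  moreover have "b t * (c t * (b t * (c t / 2 * (norm e)\<^sup>2 + r)) * norm e) / 2 + b t * r
      = b t * c t / 2 * (b t * c t / 2 * (norm e)\<^sup>2 + b t * r) * norm e + b t * r"
    by (simp add: field_simps)
  ultimately have 1: "(1 - l t) * norm z \<le> b t * c t / 2 * (b t * c t / 2 * (norm e)\<^sup>2 + b t * r) * norm e + b t * r"
    by linarith
  define \<kappa> where "\<kappa> = norm e / \<epsilon>"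
  have \<kappa>: "0 \<le> \<kappa>" "\<kappa> \<le> 1" "norm e = \<kappa> * \<epsilon>"
    using \<epsilon> by (auto simp: \<kappa>_def)
  have \<rho>: "\<rho> t \<epsilon> > 0"
    unfolding \<epsilon>_def by (rule \<rho>_root_pos[OF t])
  have r: "r \<le> \<kappa> ^ 3 * \<rho> t \<epsilon>"
  proof -
    have "1 - \<gamma> * t - \<gamma> * \<epsilon> > 0" "1 - \<gamma> * t - \<gamma> * \<epsilon> \<le> 1 - \<gamma> * t - \<gamma> * norm e"
      using gamma_ts g\<epsilon> by (auto simp: \<epsilon>_def algebra_simps)
    then have "r \<le> \<gamma>\<^sup>2 * norm e ^ 3 / ((1 - \<gamma> * t) ^ 3 * (1 - \<gamma> * t - \<gamma> * \<epsilon>))"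
      unfolding r_def \<rho>_def using s(3)
      by (intro divide_left_mono mult_left_mono mult_pos_pos mult_nonneg_nonneg zero_less_power) auto
    also have "\<dots> = \<kappa> ^ 3 * \<rho> t \<epsilon>"
      by (simp add: \<rho>_def \<kappa>(3) power_mult_distrib)
    finally show ?thesis .
  qed
  have re: "r * norm e \<le> \<kappa> ^ 3 * (\<rho> t \<epsilon> * \<epsilon>)"
    using mult_mono[OF r \<epsilon>(2)] \<kappa>(1) \<rho> by (simp add: mult_ac)
  have "b t * c t / 2 * (b t * c t / 2 * (norm e)\<^sup>2 + b t * r) * norm e + b t * r
      = (b t * c t / 2)\<^sup>2 * norm e ^ 3 + b t * c t / 2 * b t * (r * norm e) + b t * r"
    by (simp add: algebra_simps power2_eq_square power3_eq_cube)
  also have "\<dots> \<le> (b t * c t / 2)\<^sup>2 * norm e ^ 3 + b t * c t / 2 * b t * (\<kappa> ^ 3 * (\<rho> t \<epsilon> * \<epsilon>)) + b t * (\<kappa> ^ 3 * \<rho> t \<epsilon>)"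
    using r re b c by (intro add_mono mult_left_mono) auto
  also have "\<dots> = \<kappa> ^ 3 * (b t * c t / 2 * (b t * c t / 2 * \<epsilon>\<^sup>2 + b t * \<rho> t \<epsilon>) * \<epsilon> + b t * \<rho> t \<epsilon>)"
    unfolding \<kappa>(3) by (simp add: algebra_simps power2_eq_square power3_eq_cube)
  also have "\<dots> = \<kappa> ^ 3 * ((1 - l t) * (\<epsilon> - \<Delta> t))"
    unfolding \<epsilon>_def error_eq[OF t] ..
  finally have "(1 - l t) * norm z \<le> (1 - l t) * (\<kappa> ^ 3 * (\<epsilon> - \<Delta> t))"
    using 1 by (simp add: mult_ac)
  then have "norm z \<le> \<kappa> ^ 3 * (\<epsilon> - \<Delta> t)"
    using l_less_1[OF t] by simp
  then show ?thesis
    by (simp add: z_def \<kappa>_def e_def \<epsilon>_def algebra_simps)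
qed

end

end

text \<open>A zero at distance \<tau> from \<open>x0\<close> forces \<open>\<tau> \<le> \<beta> +
  \<gamma> * \<tau>\<^sup>2 / (1 - \<gamma> * \<tau>)\<close>, that is
  \<open>f \<tau> \<ge> 0\<close>, but \<open>f\<close> is negative between its two zeros.\<close>

lemma zero_in_cball:
  assumes "norm (y - x0) < tss" "T 0 y [] = 0"
  shows "norm (y - x0) \<le> ts"
proof (rule ccontr)
  define \<tau> where "\<tau> = norm (y - x0)"
  assume "\<not> norm (y - x0) \<le> ts"
  then have \<tau>: "\<tau> > ts" "\<tau> < tss" "\<tau> < 1 / \<gamma>"
    using assms less_radius by (auto simp: \<tau>_def)
  have g: "\<gamma> * \<tau> < 1"
    using \<tau> gamma by (simp add: field_simps)
  have "norm (T 0 x0 [] + (y - x0)) \<le> \<gamma> * \<tau>\<^sup>2 / (1 - \<gamma> * \<tau>)"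
    using linearisation_bound[of "y - x0"] \<tau>(3) assms(2) norm_minus_cancel[of "T 0 x0 [] + (y - x0)"]
    by (simp add: \<tau>_def T1_x0 algebra_simps del: One_nat_def)
  moreover have "\<tau> \<le> norm (T 0 x0 [] + (y - x0)) + norm (T 0 x0 [])"
    unfolding \<tau>_def using norm_triangle_ineq4[of "T 0 x0 [] + (y - x0)" "T 0 x0 []"] by simp
  ultimately have "f \<tau> \<ge> 0"
    using T0_x0 by (simp add: majorant_def)
  moreover have "f \<tau> < 0"
    unfolding f_factor[OF g] using \<tau> gamma g
    by (intro divide_neg_pos mult_neg_pos mult_pos_neg) auto
  ultimately show False by simp
qed

text \<open>Zeros are fixed points of \<open>y - T 0 y []\<close>, whose derivative on the closed
  ball has norm at most \<open>q\<close>, where \<open>1 - q = - f'(ts)\<close> is positive.\<close>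

lemma zero_unique:
  assumes "norm (y - x0) \<le> ts" "T 0 y [] = 0" "norm (z - x0) \<le> ts" "T 0 z [] = 0"
  shows "y = z"
proof -
  define q where "q = 1 / (1 - \<gamma> * ts)\<^sup>2 - 1"
  have q: "q < 1"
    using square_gt gamma_ts by (simp add: q_def divide_simps)
  have "norm ((y - T 0 y []) - (z - T 0 z [])) \<le> q * norm (y - z)"
  proof (rule differentiable_bound[where S="cball x0 ts" and f'="\<lambda>x v. v - T 1 x [v]"])
    fix x assume x: "x \<in> cball x0 ts"
    then have n: "norm (x - x0) \<le> ts"
      by (simp add: dist_norm norm_minus_commute)
    then have "x0 + (x - x0) \<in> D"
      using ts less_radius[of "norm (x - x0)"] by (intro in_D) auto
    then have "((\<lambda>x. T 0 x []) has_derivative (\<lambda>v. T 1 x [v])) (at x within cball x0 ts)"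
      using has_derivative_at_withinI[OF derivative[of x "[]" 0]] by simp
    then show "((\<lambda>x. x - T 0 x []) has_derivative (\<lambda>v. v - T 1 x [v])) (at x within cball x0 ts)"
      by (intro has_derivative_diff has_derivative_ident)
    show "onorm (\<lambda>v. v - T 1 x [v]) \<le> q"
    proof (rule onorm_bound)
      show "norm (v - T 1 x [v]) \<le> q * norm v" for v
        unfolding q_def using ts by (intro first_derivative_near_id n) auto
      have "(1 - \<gamma> * ts)\<^sup>2 \<le> 1\<^sup>2"
        using gamma_ts gamma ts by (intro power_mono) auto
      then show "0 \<le> q"
        using gamma_ts by (simp add: q_def divide_simps)
    qed
  qed (use assms in \<open>auto simp: dist_norm norm_minus_commute\<close>)
  then have "norm (y - z) \<le> q * norm (y - z)"
    using assms by simp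
  then show ?thesis
    using q by (auto simp: mult_le_cancel_right1)
qed

end

section \<open>Convergence of the iteration\<close>

text \<open>The recursions are conditional: the concrete Halley formula can be rewritten as
  \<open>step\<close> only at a point of \<open>D\<close> with invertible derivative, and the scalar
  one only for \<open>0 \<le> \<tau> k < ts\<close>. The induction for \<open>invariant\<close>
  discharges both.\<close>

locale halley_iteration = halley_family T D x0 \<beta> \<gamma> ts tss
  for T :: "nat \<Rightarrow> 'a::banach \<Rightarrow> 'a list \<Rightarrow> 'a" and D :: "'a set" and x0 :: 'a and \<beta> \<gamma> ts tss :: real +
  fixes X :: "nat \<Rightarrow> 'a" and \<tau> :: "nat \<Rightarrow> real"
  assumes X_0: "X 0 = x0" and \<tau>_0: "\<tau> 0 = 0"
    and X_Suc: "norm (X k - x0) < ts \<Longrightarrow> nonsingular (\<lambda>v. T 1 (X k) [v]) \<Longrightarrow> X (Suc k) = step (X k)"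
    and \<tau>_Suc: "0 \<le> \<tau> k \<Longrightarrow> \<tau> k < ts \<Longrightarrow> \<tau> (Suc k) = \<tau> k + \<Delta> (\<tau> k)"
begin

lemma invariant: "0 \<le> \<tau> k \<and> \<tau> k < ts \<and> norm (X k - x0) \<le> \<tau> k \<and> norm (T 0 (X k) []) \<le> f (\<tau> k)"
proof (induction k)
  case 0
  then show ?case
    using ts T0_x0 by (simp add: X_0 \<tau>_0 majorant_def)
next
  case (Suc k)
  then have t: "\<tau> k < ts" "0 \<le> \<tau> k" and x: "norm (X k - x0) \<le> \<tau> k" and G: "norm (T 0 (X k) []) \<le> f (\<tau> k)"
    by auto
  have X: "X (Suc k) = step (X k)"
    using x t by (intro X_Suc nonsingular_T1[OF x t]) auto
  have \<tau>: "\<tau> (Suc k) = \<tau> k + \<Delta> (\<tau> k)"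
    using t by (intro \<tau>_Suc)
  have "norm (X (Suc k) - x0) \<le> norm (step (X k) - X k) + norm (X k - x0)"
    unfolding X using norm_triangle_ineq[of "step (X k) - X k" "X k - x0"] by simp
  then show ?case
    using step_bound[OF x t G] value_step[OF x t G] \<Delta>_pos[OF t] \<Delta>_less[OF t] t x
    by (simp add: X \<tau>)
qed

lemmas \<tau>_bounds = invariant[THEN conjunct2, THEN conjunct1] invariant[THEN conjunct1]
lemmas X_bound = invariant[THEN conjunct2, THEN conjunct2, THEN conjunct1]
lemmas X_value = invariant[THEN conjunct2, THEN conjunct2, THEN conjunct2]

lemma X_step: "X (Suc k) = step (X k)"
  using X_bound \<tau>_bounds by (intro X_Suc nonsingular_T1[OF X_bound \<tau>_bounds]) (rule le_less_trans)

lemma \<tau>_step: "\<tau> (Suc k) = \<tau> k + \<Delta> (\<tau> k)"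
  by (rule \<tau>_Suc[OF \<tau>_bounds(2) \<tau>_bounds(1)])

lemma X_in_ball: "X k \<in> ball x0 ts"
  using X_bound[of k] \<tau>_bounds(1)[of k] by (simp add: dist_norm norm_minus_commute)

lemma increments: "k \<le> m \<Longrightarrow> norm (X m - X k) \<le> \<tau> m - \<tau> k"
proof (induction m rule: dec_induct)
  case (step m)
  have "norm (X (Suc m) - X m) \<le> \<tau> (Suc m) - \<tau> m"
    using step_bound[OF X_bound \<tau>_bounds X_value] by (simp add: X_step \<tau>_step)
  then show ?case
    using step norm_triangle_ineq[of "X (Suc m) - X m" "X m - X k"] by simp
qed simp

lemma \<tau>_convergent: "convergent \<tau>"
proof (rule Bseq_monoseq_convergent)
  show "Bseq \<tau>"
    using \<tau>_bounds by (intro BseqI'[of _ ts]) (auto intro: less_imp_le)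
  show "monoseq \<tau>"
    using \<Delta>_pos[OF \<tau>_bounds] by (intro incseq_imp_monoseq incseq_SucI) (simp add: \<tau>_step less_imp_le)
qed

lemma X_convergent: "convergent X"
  unfolding Cauchy_convergent_iff[symmetric]
proof (rule CauchyI)
  fix e :: real assume "e > 0"
  then obtain M where M: "\<And>m n. m \<ge> M \<Longrightarrow> n \<ge> M \<Longrightarrow> norm (\<tau> m - \<tau> n) < e"
    using CauchyD[OF convergent_Cauchy[OF \<tau>_convergent]] by blast
  have "norm (X m - X n) \<le> norm (\<tau> m - \<tau> n)" for m n
    using increments[of m n] increments[of n m] by (cases m n rule: le_cases) (auto simp: norm_minus_commute)
  with M show "\<exists>M. \<forall>m\<ge>M. \<forall>n\<ge>M. norm (X m - X n) < e"
    by (meson le_less_trans)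
qed

definition "xs = lim X"

lemma X_limit: "X \<longlonglongrightarrow> xs"
  using X_convergent by (simp add: xs_def convergent_LIMSEQ_iff)

lemma limit_distance: "norm (xs - X k) \<le> ts - \<tau> k"
proof (rule LIMSEQ_le_const2)
  show "(\<lambda>m. norm (X m - X k)) \<longlonglongrightarrow> norm (xs - X k)"
    by (intro tendsto_intros X_limit)
  have "norm (X m - X k) \<le> ts - \<tau> k" if "m \<ge> k" for m
    using increments[OF that] \<tau>_bounds(1)[of m] by simp
  then show "\<exists>N. \<forall>m\<ge>N. norm (X m - X k) \<le> ts - \<tau> k"
    by blast
qed

lemma limit_bound: "norm (xs - x0) \<le> ts"
  using limit_distance[of 0] by (simp add: X_0 \<tau>_0)

lemma limit_D: "xs \<in> D"
  using in_D[of "xs - x0"] limit_bound ts less_radius[of "norm (xs - x0)"] by simp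

text \<open>The values are bounded by the increments of \<tau>: \<open>b \<ge> 1\<close> gives
  \<open>f \<le> b * f = (1 - l) * \<Delta> \<le> \<Delta>\<close>. The increments vanish because
  \<tau> converges.\<close>

lemma limit_zero: "T 0 xs [] = 0"
proof -
  have "isCont (\<lambda>x. T 0 x []) xs"
    using derivative[OF limit_D, of "[]" 0] by (intro has_derivative_continuous) auto
  then have "(\<lambda>k. T 0 (X k) []) \<longlonglongrightarrow> T 0 xs []"
    using X_limit by (rule isCont_tendsto_compose)
  moreover have "(\<lambda>k. T 0 (X k) []) \<longlonglongrightarrow> 0"
  proof (rule Lim_null_comparison)
    have "norm (T 0 (X k) []) \<le> \<tau> (Suc k) - \<tau> k" for k
    proof -
      note t = \<tau>_bounds[of k]
      have "1 * f (\<tau> k) \<le> b (\<tau> k) * f (\<tau> k)"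
        using b_ge_1[OF t] f_pos[OF t] by (intro mult_right_mono) auto
      also have "\<dots> = (1 - l (\<tau> k)) * \<Delta> (\<tau> k)"
        by (rule \<Delta>_mult[OF t, symmetric])
      also have "\<dots> \<le> 1 * \<Delta> (\<tau> k)"
        using l_pos[OF t] \<Delta>_pos[OF t] by (intro mult_right_mono) auto
      finally show ?thesis
        using X_value[of k] by (simp add: \<tau>_step)
    qed
    then show "\<forall>\<^sub>F k in sequentially. norm (T 0 (X k) []) \<le> \<tau> (Suc k) - \<tau> k"
      by simp
    have "\<tau> \<longlonglongrightarrow> lim \<tau>"
      using \<tau>_convergent by (simp add: convergent_LIMSEQ_iff)
    from tendsto_diff[OF LIMSEQ_Suc[OF this] this] show "(\<lambda>k. \<tau> (Suc k) - \<tau> k) \<longlonglongrightarrow> 0"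
      by simp
  qed
  ultimately show ?thesis
    by (rule LIMSEQ_unique)
qed

lemma error_ratio: "norm (xs - X (Suc k)) \<le> (ts - \<tau> (Suc k)) * (norm (xs - X k) / (ts - \<tau> k)) ^ 3"
  unfolding X_step \<tau>_step
  by (rule error_step[OF X_bound \<tau>_bounds X_value limit_zero limit_distance])

lemma error_cubic:
  "norm (xs - X (Suc k)) \<le> 8 * \<gamma>\<^sup>2 / (3 * (2 * (1 - \<gamma> * ts)\<^sup>2 - 1)\<^sup>2) * norm (xs - X k) ^ 3"
proof -
  define K where "K = 8 * \<gamma>\<^sup>2 / (3 * (2 * (1 - \<gamma> * ts)\<^sup>2 - 1)\<^sup>2)"
  have "norm (xs - X (Suc k)) \<le> (ts - \<tau> (Suc k)) * (norm (xs - X k) / (ts - \<tau> k)) ^ 3"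
    by (rule error_ratio)
  also have "\<dots> \<le> K * (ts - \<tau> k) ^ 3 * (norm (xs - X k) / (ts - \<tau> k)) ^ 3"
    using cubic_error[OF \<tau>_bounds] \<tau>_bounds(1)[of k] by (intro mult_right_mono) (auto simp: \<tau>_step K_def)
  also have "\<dots> = K * norm (xs - X k) ^ 3"
    using \<tau>_bounds(1)[of k] by (simp add: power_divide)
  finally show ?thesis
    by (simp add: K_def)
qed

end

section \<open>From iterated Frechet derivatives and Smale's gamma to the abstract derivative
  family\<close>

lemma bounded_multilinear_slot:
  assumes "bounded_multilinear k M" "length us + length vs + 1 = k"
  shows "linear (\<lambda>v. M (us @ v # vs))"
proof -
  \<comment> \<open>The placeholder \<open>undefined\<close> is overwritten by the list
    update.\<close>
  have "linear (\<lambda>v. M ((us @ undefined # vs)[length us := v]))"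
    using assms unfolding bounded_multilinear_def by (metis Suc_eq_plus1 add_Suc_right le_add1 le_imp_less_Suc length_Cons length_append)
  then show ?thesis
    by simp
qed

text \<open>Boundedness makes the real supremum an upper bound on unit arguments; scaling each
  argument to its \<open>sgn\<close> then yields the product bound, also for zero vectors since
  \<open>sgn 0 = 0\<close>.\<close>

lemma multilinear_norm_bound:
  assumes M: "bounded_multilinear k M"
  shows "multilinear_norm k M \<ge> 0"
    and "length vs = k \<Longrightarrow> norm (M vs) \<le> multilinear_norm k M * (\<Prod>v\<leftarrow>vs. norm v)"
proof -
  obtain C where C: "\<And>vs. length vs = k \<Longrightarrow> norm (M vs) \<le> C * (\<Prod>v\<leftarrow>vs. norm v)"
    using M unfolding bounded_multilinear_def by blast
  have P: "0 \<le> (\<Prod>v\<leftarrow>vs. norm v)" for vs :: "'a list"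
    by (induction vs) auto
  have P1: "(\<Prod>v\<leftarrow>vs. norm v) \<le> 1" if "\<forall>v\<in>set vs. norm v \<le> 1" for vs :: "'a list"
    using that by (induction vs) (auto intro: mult_le_one[OF _ P])
  have unit: "norm (M vs) \<le> multilinear_norm k M" if "length vs = k" "\<forall>v\<in>set vs. norm v \<le> 1" for vs
    unfolding multilinear_norm_def
  proof (rule cSUP_upper)
    have "norm (M vs) \<le> \<bar>C\<bar>" if "length vs = k" "\<forall>v\<in>set vs. norm v \<le> 1" for vs
    proof -
      have "norm (M vs) \<le> \<bar>C\<bar> * (\<Prod>v\<leftarrow>vs. norm v)"
        using C[OF that(1)] mult_right_mono[OF abs_ge_self P] by (rule order_trans)
      also have "\<dots> \<le> \<bar>C\<bar> * 1"
        using P1[OF that(2)] by (intro mult_left_mono) auto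
      finally show ?thesis by simp
    qed
    then show "bdd_above ((\<lambda>vs. norm (M vs)) ` {vs. length vs = k \<and> (\<forall>v\<in>set vs. norm v \<le> 1)})"
      by (intro bdd_aboveI[of _ "\<bar>C\<bar>"]) auto
  qed (use that in auto)
  show nonneg: "multilinear_norm k M \<ge> 0"
    using unit[of "replicate k 0"] order_trans[OF norm_ge_zero] by auto
  \<comment> \<open>The prefix \<open>us\<close> holds the arguments already normalised.\<close>
  have normalise: "M (us @ vs) = (\<Prod>v\<leftarrow>vs. norm v) *\<^sub>R M (us @ map sgn vs)" if "length us + length vs = k" for us vs
    using that
  proof (induction vs arbitrary: us)
    case (Cons v vs)
    interpret linear "\<lambda>v. M (us @ v # vs)"
      using Cons.prems by (intro bounded_multilinear_slot[OF M]) auto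
    have "v = norm v *\<^sub>R sgn v"
      by (cases "v = 0") (auto simp: sgn_div_norm)
    then have "M (us @ v # vs) = norm v *\<^sub>R M (us @ sgn v # vs)"
      using scale[of "norm v" "sgn v"] by simp
    also have "M (us @ sgn v # vs) = (\<Prod>v\<leftarrow>vs. norm v) *\<^sub>R M (us @ sgn v # map sgn vs)"
      using Cons.IH[of "us @ [sgn v]"] Cons.prems by simp
    finally show ?case
      by simp
  qed simp
  show "norm (M vs) \<le> multilinear_norm k M * (\<Prod>v\<leftarrow>vs. norm v)" if "length vs = k"
  proof -
    have "norm (M (map sgn vs)) \<le> multilinear_norm k M"
      using that by (intro unit) (auto simp: norm_sgn)
    from mult_right_mono[OF this P[of vs]] show ?thesis
      using normalise[of "[]" vs] that P[of vs] by (simp add: mult.commute)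
  qed
qed

lemma nth_frechet_derivative_works:
  assumes "analytic_operator_on F D" "x \<in> D"
  shows "has_multilinear_derivative k (nth_frechet_derivative F k) (nth_frechet_derivative F (Suc k) x) x"
proof -
  have "\<exists>T. has_multilinear_derivative k (nth_frechet_derivative F k) T x"
    using assms unfolding analytic_operator_on_def by blast
  from someI_ex[OF this] show ?thesis
    by simp
qed

lemma has_multilinear_derivative_imp_has_derivative:
  fixes G :: "'a::real_normed_vector \<Rightarrow> 'a list \<Rightarrow> 'b::real_normed_vector"
  assumes G: "has_multilinear_derivative k G T x" and vs: "length vs = k"
  shows "((\<lambda>y. G y vs) has_derivative (\<lambda>h. T (h # vs))) (at x)"
proof (rule has_derivativeI)
  have ml: "bounded_multilinear (Suc k) T"
    using G by (simp add: has_multilinear_derivative_def)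
  have "linear (\<lambda>h. T ([] @ h # vs))"
    using vs by (intro bounded_multilinear_slot[OF ml]) auto
  moreover have "norm (T (h # vs)) \<le> norm h * (multilinear_norm (Suc k) T * (\<Prod>v\<leftarrow>vs. norm v))" for h
    using multilinear_norm_bound(2)[OF ml, of "h # vs"] vs by (simp add: mult_ac)
  ultimately show "bounded_linear (\<lambda>h. T (h # vs))"
    by (auto intro!: bounded_linear.intro bounded_linear_axioms.intro)
  define p where "p = (\<Prod>v\<leftarrow>vs. norm v)"
  have p: "p \<ge> 0"
    unfolding p_def by (induction vs) auto
  show "((\<lambda>y. (G y vs - G x vs - T ((y - x) # vs)) /\<^sub>R norm (y - x)) \<longlongrightarrow> 0) (at x)"
  proof (rule tendstoI)
    fix e :: real assume e: "e > 0"
    \<comment> \<open>The remainder carries the factor \<open>p\<close>; adding 1 covers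
      \<open>p = 0\<close> and makes the final bound strict.\<close>
    define e' where "e' = e / (p + 1)"
    have e': "e' > 0" "e' * p < e"
      using e p by (auto simp: e'_def field_simps)
    have "\<forall>\<^sub>F h in nhds 0. \<forall>vs. length vs = k \<longrightarrow>
        norm (G (x + h) vs - G x vs - T (h # vs)) \<le> e' * norm h * (\<Prod>v\<leftarrow>vs. norm v)"
      using G e'(1) unfolding has_multilinear_derivative_def by blast
    then have "\<forall>\<^sub>F h in nhds 0. norm (G (x + h) vs - G x vs - T (h # vs)) \<le> e' * norm h * p"
      unfolding p_def by (rule eventually_mono) (use vs in blast)
    then obtain d where d: "d > 0"
      and bd: "\<And>h. norm h < d \<Longrightarrow> norm (G (x + h) vs - G x vs - T (h # vs)) \<le> e' * norm h * p"
      unfolding eventually_nhds_metric by (auto simp: dist_norm)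
    have "norm ((G y vs - G x vs - T ((y - x) # vs)) /\<^sub>R norm (y - x)) < e"
      if "y \<noteq> x" "norm (y - x) < d" for y
    proof -
      have "norm (G y vs - G x vs - T ((y - x) # vs)) / norm (y - x) \<le> e' * p"
        using bd[OF that(2)] that(1) by (simp add: field_simps)
      then show ?thesis
        using e'(2) by (simp add: divide_inverse mult.commute)
    qed
    then show "\<forall>\<^sub>F y in at x. dist ((G y vs - G x vs - T ((y - x) # vs)) /\<^sub>R norm (y - x)) 0 < e"
      unfolding eventually_at using d by (intro exI[of _ d]) (auto simp: dist_norm)
  qed
qed

text \<open>Each member of the family lies below the supremum, whose finiteness is part of the
  equation with \<open>ereal \<gamma>\<close>; raising to the power \<open>k - 1\<close> removes the
  root.\<close>

lemma smale_gamma_bound: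
  fixes F :: "'a::real_normed_vector \<Rightarrow> 'b::real_normed_vector"
  assumes F: "analytic_operator_on F D" "x \<in> D"
    and A: "nonsingular (frechet_derivative F (at x))"
    and \<gamma>: "ereal \<gamma> = smale_gamma F x"
    and k: "k > 1" "length vs = k"
  shows "norm (inv (frechet_derivative F (at x)) (nth_frechet_derivative F k x vs))
    \<le> fact k * \<gamma> ^ (k - 1) * (\<Prod>v\<leftarrow>vs. norm v)"
proof -
  define B where "B = inv (frechet_derivative F (at x))"
  interpret B: bounded_linear B
    using A by (simp add: nonsingular_def B_def)
  define N where "N = nth_frechet_derivative F k x"
  define M where "M vs = B (N vs) /\<^sub>R fact k" for vs
  have N: "bounded_multilinear k N"
    using nth_frechet_derivative_works[OF F, of "k - 1"] k(1)
    by (simp add: has_multilinear_derivative_def N_def)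
  have M: "bounded_multilinear k M"
    unfolding bounded_multilinear_def
  proof (intro conjI allI impI)
    fix vs :: "'a list" and i assume "length vs = k" "i < k"
    then have "linear (\<lambda>v. N (vs[i := v]))"
      using N by (simp add: bounded_multilinear_def)
    then show "linear (\<lambda>v. M (vs[i := v]))"
      unfolding M_def by (intro linear_compose_scale_right linear_compose[OF _ B.linear_axioms, unfolded o_def])
  next
    obtain C K where C: "\<And>vs. length vs = k \<Longrightarrow> norm (N vs) \<le> C * (\<Prod>v\<leftarrow>vs. norm v)"
      and K: "K \<ge> 0" "\<And>w. norm (B w) \<le> norm w * K"
      using N B.nonneg_bounded unfolding bounded_multilinear_def by blast
    have "norm (M vs) \<le> (C * K / fact k) * (\<Prod>v\<leftarrow>vs. norm v)" if "length vs = k" for vs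
    proof -
      have "norm (B (N vs)) \<le> C * (\<Prod>v\<leftarrow>vs. norm v) * K"
        using K(2)[of "N vs"] mult_right_mono[OF C[OF that] K(1)] by linarith
      then show ?thesis
        by (simp add: M_def field_simps)
    qed
    then show "\<exists>C. \<forall>vs. length vs = k \<longrightarrow> norm (M vs) \<le> C * (\<Prod>v\<leftarrow>vs. norm v)"
      by blast
  qed
  have "ereal (root (k - 1) (multilinear_norm k M)) \<le> ereal \<gamma>"
    unfolding \<gamma> smale_gamma_def M_def N_def B_def by (rule SUP_upper) (use k in auto)
  then have "root (k - 1) (multilinear_norm k M) ^ (k - 1) \<le> \<gamma> ^ (k - 1)"
    using real_root_ge_zero[OF multilinear_norm_bound(1)[OF M]] by (intro power_mono) auto
  then have "multilinear_norm k M \<le> \<gamma> ^ (k - 1)"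
    using multilinear_norm_bound(1)[OF M] k by (simp add: real_root_pow_pos2)
  moreover have "0 \<le> (\<Prod>v\<leftarrow>vs. norm v)"
    by (induction vs) auto
  ultimately have "norm (M vs) \<le> \<gamma> ^ (k - 1) * (\<Prod>v\<leftarrow>vs. norm v)"
    using multilinear_norm_bound(2)[OF M k(2)] by (meson mult_right_mono order_trans)
  then show ?thesis
    by (simp add: M_def N_def B_def field_simps)
qed

theorem theorem7:
  fixes F :: "'a::banach \<Rightarrow> 'b::banach"
    and D :: "'a set"
    and x0 :: 'a
    and \<beta> \<gamma> \<alpha> ts tss :: real
    and x :: "nat \<Rightarrow> 'a"
    and t :: "nat \<Rightarrow> real"
  assumes "open D" and "convex D"
    and "analytic_operator_on F D"
    and "x0 \<in> D"
    and "nonsingular (frechet_derivative F (at x0))"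
    and "ereal \<gamma> = smale_gamma F x0"
    and "\<gamma> > 0"
    and "ball x0 (1 / \<gamma>) \<subseteq> D"
    and "\<beta> > 0"
    and "norm (inv (frechet_derivative F (at x0)) (F x0)) \<le> \<beta>"
    and "\<alpha> = \<beta> * \<gamma>"
    and "\<alpha> < 3 - 2 * sqrt 2"
    and "ts = (1 + \<alpha> - sqrt ((1 + \<alpha>)\<^sup>2 - 8 * \<alpha>)) / (4 * \<gamma>)"
    and "tss = (1 + \<alpha> + sqrt ((1 + \<alpha>)\<^sup>2 - 8 * \<alpha>)) / (4 * \<gamma>)"
    and "x = halley_seq F x0"
    and "t = scalar_halley_seq (majorant \<beta> \<gamma>) 0"
  shows "halley_seq_well_defined F D x0 \<and>
    (\<forall>k. x k \<in> ball x0 ts) \<and>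
    (\<exists>xs. x \<longlonglongrightarrow> xs \<and>
      xs \<in> closure (ball x0 ts) \<and> xs \<in> D \<and> F xs = 0 \<and>
      xs \<in> ball x0 tss \<and> (\<forall>y \<in> ball x0 tss. F y = 0 \<longrightarrow> y = xs) \<and>
      (\<forall>k. norm (xs - x (Suc k)) \<le> (ts - t (Suc k)) * (norm (xs - x k) / (ts - t k)) ^ 3) \<and>
      (\<forall>k. norm (xs - x (Suc k))
          \<le> 8 * \<gamma>\<^sup>2 / (3 * (2 * (1 - \<gamma> * ts)\<^sup>2 - 1)\<^sup>2) * norm (xs - x k) ^ 3))"
proof -
  define A where "A = frechet_derivative F (at x0)"
  have nsA: "nonsingular A"
    using assms(5) by (simp add: A_def)
  then have A: "bounded_linear A" "bij A" "bounded_linear (inv A)"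
    by (auto simp: nonsingular_def)
  interpret iA: bounded_linear "inv A" by fact
  have A_inv: "A (inv A w) = w" for w
    using A(2) by (simp add: bij_is_surj surj_f_inv_f)
  have inv_A: "inv A (A v) = v" for v
    using A(2) by (simp add: bij_is_inj inv_f_f)
  \<comment> \<open>These are the derivatives of \<open>G\<close>; a fixed invertible factor on the
    left changes neither the zeros nor the Halley iterates.\<close>
  define T where "T n y vs = inv A (nth_frechet_derivative F n y vs)" for n y vs
  have F': "frechet_derivative F (at y) v = A (T 1 y [v])" if "y \<in> D" for y v
  proof -
    have "F differentiable (at y)"
      using has_multilinear_derivative_imp_has_derivative[OF nth_frechet_derivative_works[OF assms(3) that, of 0], of "[]"]
      by (auto simp: differentiable_def)
    from nth_frechet_derivative_1[OF this] show ?thesis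
      by (simp add: T_def A_inv)
  qed
  interpret halley_majorant \<beta> \<gamma> ts tss
    by (rule halley_majorant_roots) (use assms in auto)
  have T1: "T 1 x0 [v] = v" for v
  proof -
    have "inv A (A v) = inv A (A (T 1 x0 [v]))"
      using F'[OF assms(4), of v] by (simp only: A_def)
    then show ?thesis
      by (simp only: inv_A)
  qed
  interpret halley_family T D x0 \<beta> \<gamma> ts tss
  proof unfold_locales
    show "open D" "\<gamma> > 0" "ball x0 (1 / \<gamma>) \<subseteq> D"
      by fact+
    show "((\<lambda>y. T n y vs) has_derivative (\<lambda>h. T (Suc n) y (h # vs))) (at y)"
      if "y \<in> D" "length vs = n" for y vs n
      unfolding T_def
      by (rule iA.has_derivative[OF has_multilinear_derivative_imp_has_derivative[OF
          nth_frechet_derivative_works[OF assms(3) that(1)] that(2)]])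
    show "\<exists>r>0. \<forall>h. norm h < r \<longrightarrow> (\<lambda>k. T k y (replicate k h) /\<^sub>R fact k) sums T 0 (y + h) []"
      if "y \<in> D" for y
    proof -
      obtain r where "r > 0" and r: "\<And>h. norm h < r \<Longrightarrow>
          (\<lambda>k. nth_frechet_derivative F k y (replicate k h) /\<^sub>R fact k) sums F (y + h)"
        using assms(3) \<open>y \<in> D\<close> unfolding analytic_operator_on_def by blast
      then show ?thesis
        using iA.sums[OF r] by (intro exI[of _ r]) (auto simp: T_def iA.scaleR)
    qed
    show "norm (T n x0 vs) \<le> fact n * \<gamma> ^ (n - 1) * (\<Prod>v\<leftarrow>vs. norm v)"
      if "0 < n" "length vs = n" for n vs
    \<comment> \<open>The supremum starts at order 2; at order 1 the normalisation gives the bound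
      with \<open>\<gamma> ^ 0\<close>.\<close>
    proof (cases "n = 1")
      case True
      then obtain v where "vs = [v]"
        using \<open>length vs = n\<close> by (auto simp: length_Suc_conv)
      then show ?thesis
        using True T1 by simp
    next
      case False
      then show ?thesis
        unfolding T_def A_def using that assms by (intro smale_gamma_bound[OF assms(3,4)]) auto
    qed
    show "T 1 x0 [v] = v" for v
      by (rule T1)
    show "norm (T 0 x0 []) \<le> \<beta>"
      using assms(10) by (simp add: T_def A_def)
  qed
  \<comment> \<open>From \<open>F'(y) = A \<circ> G'(y)\<close> the inverse is
    \<open>P y \<circ> inv A\<close>, and the inner \<open>inv A\<close> is absorbed into
    \<open>T\<close>; so \<open>F\<close> and \<open>G\<close> have the same Newton increment and
    the same \<open>L\<close>.\<close>
  have comp: "nonsingular (frechet_derivative F (at y))"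
    and inv_comp: "inv (frechet_derivative F (at y)) w = P y (inv A w)"
    if "y \<in> D" "nonsingular (\<lambda>v. T 1 y [v])" for y w
  proof -
    have eq: "frechet_derivative F (at y) = A \<circ> (\<lambda>v. T 1 y [v])"
      using F'[OF that(1)] by (simp add: fun_eq_iff)
    have T1y: "bounded_linear (\<lambda>v. T 1 y [v])" "bij (\<lambda>v. T 1 y [v])" "bounded_linear (P y)"
      using that(2) by (auto simp: nonsingular_def P_def)
    have inv: "inv (frechet_derivative F (at y)) = P y \<circ> inv A"
      unfolding eq P_def using A(2) T1y(2) by (rule o_inv_distrib)
    then show "inv (frechet_derivative F (at y)) w = P y (inv A w)"
      by simp
    show "nonsingular (frechet_derivative F (at y))"
      unfolding nonsingular_def inv unfolding eq o_def
      using bij_comp[OF T1y(2) A(2)] A T1y by (auto simp: o_def intro: bounded_linear_compose)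
  qed
  have halley_L: "halley_L F y = L y" if "y \<in> D" "nonsingular (\<lambda>v. T 1 y [v])" for y
    by (simp add: fun_eq_iff halley_L_def L_def Let_def inv_comp[OF that] T_def)
  interpret halley_iteration T D x0 \<beta> \<gamma> ts tss x t
  proof
    show "x 0 = x0" "t 0 = 0"
      by (simp_all add: assms)
    show "x (Suc k) = step (x k)" if "norm (x k - x0) < ts" "nonsingular (\<lambda>v. T 1 (x k) [v])" for k
    proof -
      have "x k \<in> D"
        using in_D[of "x k - x0"] that(1) ts less_radius[of "norm (x k - x0)"] by simp
      note * = this that(2)
      have "x (Suc k) = x k - inv (\<lambda>v. v - halley_L F (x k) v) (inv (frechet_derivative F (at (x k))) (F (x k)))"
        by (simp add: assms(15) Let_def)
      also have "\<dots> = step (x k)"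
        unfolding halley_L[OF *] inv_comp[OF *] by (simp add: step_def T_def)
      finally show ?thesis .
    qed
    show "t (Suc k) = t k + \<Delta> (t k)" if "0 \<le> t k" "t k < ts" for k
      using scalar_halley_step[OF that(2,1)] by (simp add: assms(16) Let_def)
  qed
  have zero: "F y = 0 \<longleftrightarrow> T 0 y [] = 0" for y
  proof
    assume "T 0 y [] = 0"
    then have "A (inv A (F y)) = A (inv A 0)"
      by (simp add: T_def iA.zero)
    then show "F y = 0"
      by (simp only: A_inv)
  qed (simp add: T_def iA.zero)
  show ?thesis
  proof (intro conjI exI[of _ xs] allI ballI impI)
    have "x k \<in> D" "nonsingular (frechet_derivative F (at (x k)))" "nonsingular (\<lambda>v. v - halley_L F (x k) v)" for k
      using x_D[OF X_bound \<tau>_bounds] nonsingular_T1[OF X_bound \<tau>_bounds]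
        nonsingular_L[OF X_bound \<tau>_bounds X_value] by (simp_all add: comp halley_L)
    then show "halley_seq_well_defined F D x0"
      by (simp add: halley_seq_well_defined_def Let_def flip: assms(15))
    show "x k \<in> ball x0 ts" for k
      by (rule X_in_ball)
    show "x \<longlonglongrightarrow> xs"
      by (rule X_limit)
    show "xs \<in> closure (ball x0 ts)"
      using limit_bound ts by (simp add: dist_norm norm_minus_commute)
    show "xs \<in> D"
      by (rule limit_D)
    show "F xs = 0"
      unfolding zero by (rule limit_zero)
    show "xs \<in> ball x0 tss"
      using limit_bound ts by (simp add: dist_norm norm_minus_commute)
    show "y = xs" if "y \<in> ball x0 tss" "F y = 0" for y
    proof (rule zero_unique[OF _ _ limit_bound limit_zero])
      show "T 0 y [] = 0"
        using that(2) zero by simp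
      then show "norm (y - x0) \<le> ts"
        using that(1) by (intro zero_in_cball) (auto simp: dist_norm norm_minus_commute)
    qed
    show "norm (xs - x (Suc k)) \<le> (ts - t (Suc k)) * (norm (xs - x k) / (ts - t k)) ^ 3" for k
      by (rule error_ratio)
    show "norm (xs - x (Suc k)) \<le> 8 * \<gamma>\<^sup>2 / (3 * (2 * (1 - \<gamma> * ts)\<^sup>2 - 1)\<^sup>2) * norm (xs - x k) ^ 3" for k
      by (rule error_cubic)
  qed
qed

end
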